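(* Let $\mathfrak g$ be a simple finite-dimensional complex Lie algebra with triangular decomposition $\mathfrak g=\mathfrak n_-\oplus\mathfrak h\oplus\mathfrak n_+$ and $\mathfrak b=\mathfrak h\oplus\mathfrak n_+$, and let $\hat{\mathfrak g}$ be the corresponding untwisted affine Lie algebra with standard Borel subalgebra $\hat{\mathfrak b}=\hat{\mathfrak h}\oplus\hat{\mathfrak n}_+$. For every positive integer $l$, the cardinality of the set of all possible supports of nonzero ideals of $\hat{\mathfrak b}$ contained in $\hat{\mathfrak n}_+$ and of level $l$ does not exceed the fourth power of the number of ideals of $\mathfrak b$ contained in $\mathfrak n_+$.
   Context: $\hat{\mathfrak g}=\mathfrak g\otimes\mathbb C[t,t^{-1}]\oplus\mathbb Cc\oplus\mathbb Cd$ is the untwisted affine Lie algebra (universal central extension of the loop algebra, with derivation $d$, $[d,x\otimes t^k]=k\,x\otimes t^k$), $\hat{\mathfrak h}=\mathfrak h\oplus\mathbb Cc\oplus\mathbb Cd$; $\hat{\mathfrak n}_+$ is spanned by $\mathfrak n_+\otimes1$ and all $x\otimes t^k$, $x\in\mathfrak g$, $k>0$. $\hat{\mathfrak g}_\alpha$ is a root space, $\delta$ the indivisible positive imaginary root ($\hat{\mathfrak g}_{k\delta}=\mathfrak h\otimes t^k$ for $k\neq 0$), $\hat\Delta_+$ the set of roots of $\hat{\mathfrak n}_+$. For an ideal $\mathfrak i$ of $\hat{\mathfrak b}$ contained in $\hat{\mathfrak n}_+$, its support is $\mathrm{supp}(\mathfrak i)=\{\alpha\in\hat\Delta_+:\mathfrak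 i\cap\hat{\mathfrak g}_\alpha\ne0\}$. The *level* of a nonzero such ideal is the minimal positive integer $l$ with $l\delta\in\mathrm{supp}(\mathfrak i)$. *)

theory Defs
  imports Complex_Main "HOL-Library.Poly_Mapping" "HOL-Library.Product_Plus"
begin

section \<open>Complex Lie algebras\<close>

locale lie_algebra = vector_space scale
  for scale :: "complex \<Rightarrow> 'a::ab_group_add \<Rightarrow> 'a" (infixr \<open>*s\<close> 75) +
  fixes lie :: "'a \<Rightarrow> 'a \<Rightarrow> 'a"
  assumes linear_lie_right: "Vector_Spaces.linear scale scale (\<lambda>y. lie x y)"
    and linear_lie_left: "Vector_Spaces.linear scale scale (\<lambda>x. lie x y)"
    and lie_self [simp]: "lie x x = 0"
    and jacobi: "lie x (lie y z) + lie y (lie z x) + lie z (lie x y) = 0"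
begin

definition subalgebra :: "'a set \<Rightarrow> bool" where
  "subalgebra L \<longleftrightarrow> subspace L \<and> (\<forall>x\<in>L. \<forall>y\<in>L. lie x y \<in> L)"

definition ideal_of :: "'a set \<Rightarrow> 'a set \<Rightarrow> bool" where
  "ideal_of L I \<longleftrightarrow> subspace I \<and> I \<subseteq> L \<and> (\<forall>x\<in>L. \<forall>y\<in>I. lie x y \<in> I)"

definition lie_product :: "'a set \<Rightarrow> 'a set \<Rightarrow> 'a set" where
  "lie_product A B = span {lie x y | x y. x \<in> A \<and> y \<in> B}"

primrec lower_central :: "'a set \<Rightarrow> nat \<Rightarrow> 'a set" where
  "lower_central L 0 = L"
| "lower_central L (Suc n) = lie_product L (lower_central L n)"

definition nilpotent :: "'a set \<Rightarrow> bool" where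
  "nilpotent L \<longleftrightarrow> (\<exists>n. lower_central L n = {0})"

definition normalizer :: "'a set \<Rightarrow> 'a set" where
  "normalizer L = {x. \<forall>y\<in>L. lie x y \<in> L}"

definition cartan_subalgebra :: "'a set \<Rightarrow> bool" where
  "cartan_subalgebra H \<longleftrightarrow> subalgebra H \<and> nilpotent H \<and> normalizer H = H"

text \<open>A functional on a subspace \<open>H\<close> is represented by the function that extends it by the value
  0 outside of \<open>H\<close>.  The representation is unique, and the vector space operations of the dual
  space are the pointwise ones.\<close>

definition dual :: "'a set \<Rightarrow> ('a \<Rightarrow> complex) set" where
  "dual H = {f. (\<forall>x\<in>H. \<forall>y\<in>H. f (x + y) = f x + f y) \<and>
                (\<forall>c. \<forall>x\<in>H. f (c *s x) = c * f x) \<and> (\<forall>x. x \<notin> H \<longrightarrow> f x = 0)}"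

definition root_space :: "'a set \<Rightarrow> ('a \<Rightarrow> complex) \<Rightarrow> 'a set" where
  "root_space H \<alpha> = {x. \<forall>h\<in>H. lie h x = \<alpha> h *s x}"

definition roots :: "'a set \<Rightarrow> ('a \<Rightarrow> complex) set" where
  "roots H = {\<alpha> \<in> dual H. \<alpha> \<noteq> (\<lambda>_. 0) \<and> root_space H \<alpha> \<noteq> {0}}"

definition nat_cone :: "('a \<Rightarrow> complex) set \<Rightarrow> ('a \<Rightarrow> complex) set" where
  "nat_cone \<Pi> = {\<alpha>. \<exists>n :: ('a \<Rightarrow> complex) \<Rightarrow> nat. \<alpha> = (\<lambda>x. \<Sum>\<beta>\<in>\<Pi>. of_nat (n \<beta>) * \<beta> x)}"

definition root_base :: "'a set \<Rightarrow> ('a \<Rightarrow> complex) set \<Rightarrow> bool" where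
  "root_base H \<Pi> \<longleftrightarrow> finite \<Pi> \<and> \<Pi> \<subseteq> roots H \<and>
     (\<forall>c. (\<forall>x. (\<Sum>\<beta>\<in>\<Pi>. c \<beta> * \<beta> x) = 0) \<longrightarrow> (\<forall>\<beta>\<in>\<Pi>. c \<beta> = (0 :: complex))) \<and>
     (\<forall>\<alpha>\<in>roots H. \<alpha> \<in> nat_cone \<Pi> \<or> (\<lambda>x. - \<alpha> x) \<in> nat_cone \<Pi>)"

definition triangular_decomposition :: "'a set \<Rightarrow> 'a set \<Rightarrow> 'a set \<Rightarrow> bool" where
  "triangular_decomposition Nm H Np \<longleftrightarrow>
     cartan_subalgebra H \<and>
     (\<exists>\<Pi>. root_base H \<Pi> \<and>
        Np = span (\<Union>\<alpha>\<in>{\<alpha>\<in>roots H. \<alpha> \<in> nat_cone \<Pi>}. root_space H \<alpha>) \<and>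
        Nm = span (\<Union>\<alpha>\<in>{\<alpha>\<in>roots H. (\<lambda>x. - \<alpha> x) \<in> nat_cone \<Pi>}. root_space H \<alpha>)) \<and>
     bij_betw (\<lambda>(u, v, w). u + v + w) (Nm \<times> H \<times> Np) UNIV"

definition borel :: "'a set \<Rightarrow> 'a set \<Rightarrow> 'a set" where
  "borel H Np = {x + y | x y. x \<in> H \<and> y \<in> Np}"

definition borel_ideals :: "'a set \<Rightarrow> 'a set \<Rightarrow> 'a set set" where
  "borel_ideals H Np = {I. ideal_of (borel H Np) I \<and> I \<subseteq> Np}"

definition trace :: "('a \<Rightarrow> 'a) \<Rightarrow> complex" where
  "trace f = (let B = extend_basis {} in \<Sum>b\<in>B. representation B (f b) b)"

definition killing :: "'a \<Rightarrow> 'a \<Rightarrow> complex" where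
  "killing x y = trace (\<lambda>z. lie x (lie y z))"

lemma lie_bilinear [simp]:
  "lie (x + y) z = lie x z + lie y z" "lie x (y + z) = lie x y + lie x z"
  "lie (c *s x) z = c *s lie x z" "lie x (c *s z) = c *s lie x z"
  "lie 0 z = 0" "lie x 0 = 0"
proof -
  interpret l: Vector_Spaces.linear scale scale "\<lambda>x. lie x z" by (rule linear_lie_left)
  interpret r: Vector_Spaces.linear scale scale "\<lambda>z. lie x z" by (rule linear_lie_right)
  show "lie (x + y) z = lie x z + lie y z" "lie x (y + z) = lie x y + lie x z"
    "lie (c *s x) z = c *s lie x z" "lie x (c *s z) = c *s lie x z"
    "lie 0 z = 0" "lie x 0 = 0"
    by (simp_all add: l.add r.add l.scale r.scale)
qed

lemma lie_skew: "lie x y = - lie y x"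
proof -
  have "0 = lie (x + y) (x + y)" by simp
  also have "\<dots> = lie x y + lie y x"
    unfolding lie_bilinear by (simp add: algebra_simps)
  finally show ?thesis by (simp add: eq_neg_iff_add_eq_0)
qed

end

locale finite_dimensional_lie_algebra = lie_algebra +
  assumes finite_dimensional: "\<exists>B. finite B \<and> span B = UNIV"

locale simple_lie_algebra = finite_dimensional_lie_algebra +
  assumes nonabelian: "\<exists>x y. lie x y \<noteq> 0"
    and simple: "ideal_of UNIV I \<Longrightarrow> I = {0} \<or> I = UNIV"


section \<open>The Killing form\<close>

context finite_dimensional_lie_algebra
begin

lemma ex_basis:
  obtains B where "B = extend_basis {}" "finite B" "independent B" "span B = UNIV"
proof -
  have i: "independent {}" by (rule independent_empty)
  have "independent (extend_basis {})" "span (extend_basis {}) = UNIV"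
    using independent_extend_basis[OF i] span_extend_basis[OF i] by auto
  moreover from this finite_dimensional have "finite (extend_basis {})"
    using independent_span_bound by (metis subset_UNIV)
  ultimately show ?thesis using that by blast
qed

lemma trace_add: "trace (\<lambda>x. f x + g x) = trace f + trace g"
proof -
  obtain B where B: "B = extend_basis {}" "finite B" "independent B" "span B = UNIV"
    by (rule ex_basis)
  then show ?thesis
    by (simp add: trace_def Let_def flip: B(1)) (simp add: representation_add sum.distrib)
qed

lemma trace_scale: "trace (\<lambda>x. c *s f x) = c * trace f"
proof -
  obtain B where B: "B = extend_basis {}" "finite B" "independent B" "span B = UNIV"
    by (rule ex_basis)
  then show ?thesis
    by (simp add: trace_def Let_def flip: B(1)) (simp add: representation_scale sum_distrib_left)
qed

lemma trace_commute:
  assumes f: "Vector_Spaces.linear scale scale f" and g: "Vector_Spaces.linear scale scale g"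
  shows "trace (\<lambda>x. f (g x)) = trace (\<lambda>x. g (f x))"
proof -
  obtain B where B: "B = extend_basis {}" "finite B" "independent B" "span B = UNIV"
    by (rule ex_basis)
  have expand: "v = (\<Sum>b\<in>B. representation B v b *s b)" for v
    using sum_representation_eq[of B v B] B by simp
  have *: "representation B (p (q b)) b
      = (\<Sum>c\<in>B. representation B (q b) c * representation B (p c) b)"
    if p: "Vector_Spaces.linear scale scale p" for p q b
  proof -
    interpret p: Vector_Spaces.linear scale scale p by fact
    have "p (q b) = (\<Sum>c\<in>B. representation B (q b) c *s p c)"
      by (subst expand[of "q b"]) (simp add: p.sum p.scale)
    also have "representation B \<dots> b = (\<Sum>c\<in>B. representation B (q b) c * representation B (p c) b)"
      using B by (simp add: representation_sum representation_scale)
    finally show ?thesis .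
  qed
  have "trace (\<lambda>x. f (g x))
      = (\<Sum>b\<in>B. \<Sum>c\<in>B. representation B (g b) c * representation B (f c) b)"
    by (simp add: trace_def Let_def *[OF f] flip: B(1))
  also have "\<dots> = (\<Sum>c\<in>B. \<Sum>b\<in>B. representation B (f c) b * representation B (g b) c)"
    by (subst sum.swap) (simp add: mult.commute)
  also have "\<dots> = trace (\<lambda>x. g (f x))"
    by (simp add: trace_def Let_def *[OF g] flip: B(1))
  finally show ?thesis .
qed

lemma killing_bilinear [simp]:
  "killing (x + y) z = killing x z + killing y z" "killing x (y + z) = killing x y + killing x z"
  "killing (c *s x) z = c * killing x z" "killing x (c *s z) = c * killing x z"
  "killing 0 z = 0" "killing x 0 = 0"
proof -
  show s: "killing (c *s x) z = c * killing x z" "killing x (c *s z) = c * killing x z" for c x z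
    by (simp_all add: killing_def trace_scale)
  show "killing (x + y) z = killing x z + killing y z" "killing x (y + z) = killing x y + killing x z"
    by (simp_all add: killing_def trace_add)
  show "killing 0 z = 0" "killing x 0 = 0"
    using s(1)[of 0 0 z] s(2)[of x 0 0] by simp_all
qed

lemma killing_commute: "killing x y = killing y x"
  unfolding killing_def by (rule trace_commute) (rule linear_lie_right)+

lemma killing_minus [simp]: "killing (- x) y = - killing x y" "killing x (- y) = - killing x y"
  using killing_bilinear(3)[of "-1" x y] killing_bilinear(4)[of x "-1" y] by simp_all

lemma lie_minus [simp]: "lie (- x) y = - lie x y" "lie x (- y) = - lie x y"
  using lie_bilinear(3)[of "-1" x y] lie_bilinear(4)[of x "-1" y] by simp_all

lemma lie_diff: "lie x (y - z) = lie x y - lie x z"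
  using lie_bilinear(2)[of x y "- z"] by simp

lemma lie_lie: "lie (lie x y) z = lie x (lie y z) - lie y (lie x z)"
proof -
  have "lie (lie x y) z = - lie z (lie x y)" by (rule lie_skew)
  also have "\<dots> = lie x (lie y z) + lie y (lie z x)"
    using jacobi[of x y z] by (simp add: neg_eq_iff_add_eq_0 algebra_simps)
  also have "lie z x = - lie x z" by (rule lie_skew)
  finally show ?thesis by simp
qed

lemma killing_invariant: "killing (lie x y) z = killing x (lie y z)"
proof -
  let ?X = "lie x" and ?Y = "lie y" and ?Z = "lie z"
  have lin: "Vector_Spaces.linear scale scale (\<lambda>v. ?X (?Z v))"
    using Vector_Spaces.linear_compose[OF linear_lie_right linear_lie_right, of x z]
    by (simp add: comp_def)
  have "killing (lie x y) z = trace (\<lambda>v. ?X (?Y (?Z v)) + (-1) *s ?Y (?X (?Z v)))"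
    by (simp add: killing_def lie_lie)
  also have "\<dots> = trace (\<lambda>v. ?X (?Y (?Z v))) - trace (\<lambda>v. ?Y (?X (?Z v)))"
    by (simp only: trace_add trace_scale) simp
  also have "trace (\<lambda>v. ?Y (?X (?Z v))) = trace (\<lambda>v. ?X (?Z (?Y v)))"
    by (rule trace_commute[OF linear_lie_right lin])
  also have "trace (\<lambda>v. ?X (?Y (?Z v))) - \<dots> = trace (\<lambda>v. ?X (?Y (?Z v)) + (-1) *s ?X (?Z (?Y v)))"
    by (simp only: trace_add trace_scale) simp
  also have "\<dots> = killing x (lie y z)"
    by (simp add: killing_def lie_lie lie_diff)
  finally show ?thesis .
qed

end


section \<open>The affine Lie algebra\<close>

text \<open>The loop algebra is the type \<open>int \<Rightarrow>\<^sub>0 'a\<close>, where \<open>single k x\<close> stands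
  for \<open>x \<otimes> t^k\<close>, and the triple \<open>(f, a, b)\<close> stands for \<open>f + a c + b d\<close>.  The cocycle
  uses the Killing form; any other normalisation of the invariant form only rescales \<open>c\<close>.\<close>

abbreviation lookup where "lookup \<equiv> Poly_Mapping.lookup"
abbreviation keys where "keys \<equiv> Poly_Mapping.keys"
abbreviation single where "single \<equiv> Poly_Mapping.single"

type_synonym 'a affine = "(int \<Rightarrow>\<^sub>0 'a) \<times> complex \<times> complex"

context lie_algebra
begin

definition loop_scale :: "complex \<Rightarrow> (int \<Rightarrow>\<^sub>0 'a) \<Rightarrow> (int \<Rightarrow>\<^sub>0 'a)" where
  "loop_scale a f = Poly_Mapping.map (scale a) f"

definition loop_lie :: "(int \<Rightarrow>\<^sub>0 'a) \<Rightarrow> (int \<Rightarrow>\<^sub>0 'a) \<Rightarrow> (int \<Rightarrow>\<^sub>0 'a)" where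
  "loop_lie f g = (\<Sum>m\<in>keys f. \<Sum>n\<in>keys g. single (m + n) (lie (lookup f m) (lookup g n)))"

definition loop_deriv :: "(int \<Rightarrow>\<^sub>0 'a) \<Rightarrow> (int \<Rightarrow>\<^sub>0 'a)" where
  "loop_deriv f = (\<Sum>k\<in>keys f. single k (of_int k *s lookup f k))"

definition loop_cocycle :: "(int \<Rightarrow>\<^sub>0 'a) \<Rightarrow> (int \<Rightarrow>\<^sub>0 'a) \<Rightarrow> complex" where
  "loop_cocycle f g = (\<Sum>m\<in>keys f. of_int m * killing (lookup f m) (lookup g (- m)))"

fun aff_scale :: "complex \<Rightarrow> 'a affine \<Rightarrow> 'a affine" where
  "aff_scale s (f, a, b) = (loop_scale s f, s * a, s * b)"

fun aff_lie :: "'a affine \<Rightarrow> 'a affine \<Rightarrow> 'a affine" where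
  "aff_lie (f, a, b) (g, a', b') =
     (loop_lie f g + loop_scale b (loop_deriv g) - loop_scale b' (loop_deriv f),
      loop_cocycle f g, 0)"

end

lemma poly_mapping_sum_single: "(f :: 'k \<Rightarrow>\<^sub>0 'b::comm_monoid_add) = (\<Sum>k\<in>keys f. single k (lookup f k))"
  by (rule poly_mapping_eqI) (auto simp: lookup_sum lookup_single when_def in_keys_iff)

lemma additive_poly_mapping_ext:
  fixes F G :: "('k \<Rightarrow>\<^sub>0 'b::ab_group_add) \<Rightarrow> 'c::ab_group_add"
  assumes "\<And>f g. F (f + g) = F f + F g" "\<And>f g. G (f + g) = G f + G g"
    and "\<And>k x. F (single k x) = G (single k x)"
  shows "F f = G f"
proof -
  have "F 0 = 0" "G 0 = 0" using assms(1)[of 0 0] assms(2)[of 0 0] by simp_all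
  then have "F (sum h A) = (\<Sum>x\<in>A. F (h x)) \<and> G (sum h A) = (\<Sum>x\<in>A. G (h x))"
    for h :: "'k \<Rightarrow> 'k \<Rightarrow>\<^sub>0 'b" and A
    by (induction A rule: infinite_finite_induct) (simp_all add: assms(1,2))
  then show ?thesis
    by (subst (1 2) poly_mapping_sum_single) (simp add: assms(3))
qed

context finite_dimensional_lie_algebra
begin

lemma lookup_loop_scale [simp]: "lookup (loop_scale a f) k = a *s lookup f k"
  by (auto simp: loop_scale_def Poly_Mapping.map.rep_eq when_def)

lemma lookup_loop_deriv [simp]: "lookup (loop_deriv f) k = of_int k *s lookup f k"
  by (auto simp: loop_deriv_def lookup_sum lookup_single when_def in_keys_iff)

lemma loop_lie_supset:
  assumes "finite A" "keys f \<subseteq> A" "finite B" "keys g \<subseteq> B"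
  shows "loop_lie f g = (\<Sum>m\<in>A. \<Sum>n\<in>B. single (m + n) (lie (lookup f m) (lookup g n)))"
proof -
  have "loop_lie f g = (\<Sum>m\<in>keys f. \<Sum>n\<in>B. single (m + n) (lie (lookup f m) (lookup g n)))"
    unfolding loop_lie_def using assms
    by (intro sum.cong refl sum.mono_neutral_left) (auto simp: in_keys_iff)
  also have "\<dots> = (\<Sum>m\<in>A. \<Sum>n\<in>B. single (m + n) (lie (lookup f m) (lookup g n)))"
    using assms by (intro sum.mono_neutral_left) (auto simp: in_keys_iff)
  finally show ?thesis .
qed

lemma loop_lie_bilinear:
  "loop_lie (f + f') g = loop_lie f g + loop_lie f' g"
  "loop_lie f (g + g') = loop_lie f g + loop_lie f g'"
  "loop_lie (loop_scale a f) g = loop_scale a (loop_lie f g)"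
  "loop_lie f (loop_scale a g) = loop_scale a (loop_lie f g)"
proof -
  let ?A = "keys f \<union> keys f' \<union> keys (f + f') \<union> keys (loop_scale a f)"
  let ?B = "keys g \<union> keys g' \<union> keys (g + g') \<union> keys (loop_scale a g)"
  note sup = loop_lie_supset[of ?A _ ?B]
  have lsc: "loop_scale a (sum h C) = (\<Sum>x\<in>C. loop_scale a (h x))" for h and C :: "int set"
    by (rule poly_mapping_eqI) (simp add: lookup_sum scale_sum_right)
  have ss: "loop_scale a (single k x) = single k (a *s x)" for k x
    by (rule poly_mapping_eqI) (simp add: lookup_single when_def)
  show "loop_lie (f + f') g = loop_lie f g + loop_lie f' g"
    by (subst (1 2 3) sup) (auto simp: lookup_add single_add sum.distrib)
  show "loop_lie f (g + g') = loop_lie f g + loop_lie f g'"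
    by (subst (1 2 3) sup) (auto simp: lookup_add single_add sum.distrib)
  show "loop_lie (loop_scale a f) g = loop_scale a (loop_lie f g)"
    by (subst (1 2) sup) (auto simp: lsc ss)
  show "loop_lie f (loop_scale a g) = loop_scale a (loop_lie f g)"
    by (subst (1 2) sup) (auto simp: lsc ss)
qed

lemma loop_lie_single: "loop_lie (single m x) (single n y) = single (m + n) (lie x y)"
  by (subst loop_lie_supset[of "{m}" _ "{n}"]) auto

lemma loop_cocycle_supset:
  assumes "finite A" "keys f \<subseteq> A"
  shows "loop_cocycle f g = (\<Sum>m\<in>A. of_int m * killing (lookup f m) (lookup g (- m)))"
  unfolding loop_cocycle_def using assms
  by (intro sum.mono_neutral_left) (auto simp: in_keys_iff)

lemma loop_cocycle_bilinear:
  "loop_cocycle (f + f') g = loop_cocycle f g + loop_cocycle f' g"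
  "loop_cocycle f (g + g') = loop_cocycle f g + loop_cocycle f g'"
  "loop_cocycle (loop_scale a f) g = a * loop_cocycle f g"
  "loop_cocycle f (loop_scale a g) = a * loop_cocycle f g"
proof -
  let ?A = "keys f \<union> keys f' \<union> keys (f + f') \<union> keys (loop_scale a f)"
  note sup = loop_cocycle_supset[of ?A]
  show "loop_cocycle (f + f') g = loop_cocycle f g + loop_cocycle f' g"
    by (subst (1 2 3) sup) (auto simp: lookup_add sum.distrib algebra_simps)
  show "loop_cocycle f (g + g') = loop_cocycle f g + loop_cocycle f g'"
    by (subst (1 2 3) sup) (auto simp: lookup_add sum.distrib algebra_simps)
  show "loop_cocycle (loop_scale a f) g = a * loop_cocycle f g"
    by (subst (1 2) sup) (auto simp: sum_distrib_left algebra_simps)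
  show "loop_cocycle f (loop_scale a g) = a * loop_cocycle f g"
    by (subst (1 2) sup) (auto simp: sum_distrib_left algebra_simps)
qed

lemma loop_cocycle_single:
  "loop_cocycle (single m x) (single n y) = (if m + n = 0 then of_int m * killing x y else 0)"
  by (subst loop_cocycle_supset[of "{m}"]) (auto simp: lookup_single when_def)

lemma loop_deriv_simps:
  "loop_deriv (f + g) = loop_deriv f + loop_deriv g"
  "loop_deriv (loop_scale a f) = loop_scale a (loop_deriv f)"
  "loop_deriv (single k x) = single k (of_int k *s x)"
  by (auto intro!: poly_mapping_eqI simp: lookup_add lookup_single when_def algebra_simps mult.commute)

lemma loop_scale_simps:
  "loop_scale a (f + g) = loop_scale a f + loop_scale a g"
  "loop_scale a (f - g) = loop_scale a f - loop_scale a g"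
  "loop_scale (a + b) f = loop_scale a f + loop_scale b f"
  "loop_scale a (loop_scale b f) = loop_scale (a * b) f"
  "loop_scale 1 f = f"
  "loop_scale 0 f = 0"
  "loop_scale a (- f) = - loop_scale a f"
  "loop_scale a (single k x) = single k (a *s x)"
  by (auto intro!: poly_mapping_eqI simp: lookup_add lookup_minus lookup_single when_def algebra_simps)

lemma aff_vector_space: "vector_space aff_scale"
  by unfold_locales
    (auto simp: loop_scale_simps algebra_simps)

lemma aff_bilinear:
  "aff_lie (x + y) z = aff_lie x z + aff_lie y z"
  "aff_lie z (x + y) = aff_lie z x + aff_lie z y"
  "aff_lie (aff_scale s x) z = aff_scale s (aff_lie x z)"
  "aff_lie z (aff_scale s x) = aff_scale s (aff_lie z x)"
proof -
  obtain f a a' g b b' h c c' where "x = (f, a, a')" "y = (g, b, b')" "z = (h, c, c')"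
    by (metis prod_cases3)
  then show
    "aff_lie (x + y) z = aff_lie x z + aff_lie y z"
    "aff_lie z (x + y) = aff_lie z x + aff_lie z y"
    "aff_lie (aff_scale s x) z = aff_scale s (aff_lie x z)"
    "aff_lie z (aff_scale s x) = aff_scale s (aff_lie z x)"
    by (simp_all add: loop_lie_bilinear loop_cocycle_bilinear loop_scale_simps loop_deriv_simps
        algebra_simps)
qed

lemma loop_zero [simp]:
  "loop_lie 0 f = 0" "loop_lie f 0 = 0" "loop_cocycle 0 f = 0" "loop_cocycle f 0 = 0"
  "loop_deriv 0 = 0" "loop_scale a 0 = 0"
  by (auto simp: loop_lie_def loop_cocycle_def loop_deriv_def intro: poly_mapping_eqI)

lemma loop_lie_skew: "loop_lie f g = - loop_lie g f"
proof (rule additive_poly_mapping_ext[where F = "\<lambda>f. loop_lie f g"])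
  fix k x
  show "loop_lie (single k x) g = - loop_lie g (single k x)"
  proof (rule additive_poly_mapping_ext[where F = "loop_lie (single k x)"])
    fix l y
    show "loop_lie (single k x) (single l y) = - loop_lie (single l y) (single k x)"
      unfolding loop_lie_single lie_skew[of x y] by (simp add: add.commute single_uminus)
  qed (simp_all add: loop_lie_bilinear)
qed (simp_all add: loop_lie_bilinear)

lemma loop_cocycle_skew: "loop_cocycle f g = - loop_cocycle g f"
proof (rule additive_poly_mapping_ext[where F = "\<lambda>f. loop_cocycle f g"])
  fix k x
  show "loop_cocycle (single k x) g = - loop_cocycle g (single k x)"
  proof (rule additive_poly_mapping_ext[where F = "loop_cocycle (single k x)"])
    fix l y
    show "loop_cocycle (single k x) (single l y) = - loop_cocycle (single l y) (single k x)"
    proof (cases "k + l = 0")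
      case True
      then have "l = - k" by simp
      then show ?thesis by (simp add: loop_cocycle_single killing_commute[of y])
    qed (simp add: loop_cocycle_single add.commute)
  qed (simp_all add: loop_cocycle_bilinear)
qed (simp_all add: loop_cocycle_bilinear)

lemma loop_jacobi: "loop_lie f (loop_lie g h) = loop_lie (loop_lie f g) h + loop_lie g (loop_lie f h)"
proof (rule additive_poly_mapping_ext[where F = "\<lambda>f. loop_lie f (loop_lie g h)"])
  fix k x
  show "loop_lie (single k x) (loop_lie g h) =
    loop_lie (loop_lie (single k x) g) h + loop_lie g (loop_lie (single k x) h)"
  proof (rule additive_poly_mapping_ext[where F = "\<lambda>g. loop_lie (single k x) (loop_lie g h)"])
    fix l y
    show "loop_lie (single k x) (loop_lie (single l y) h) =
      loop_lie (loop_lie (single k x) (single l y)) h + loop_lie (single l y) (loop_lie (single k x) h)"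
      by (rule additive_poly_mapping_ext[where F = "\<lambda>h. loop_lie (single k x) (loop_lie (single l y) h)"])
        (simp_all add: loop_lie_bilinear loop_lie_single lie_lie ac_simps flip: single_add)
  qed (simp_all add: loop_lie_bilinear algebra_simps)
qed (simp_all add: loop_lie_bilinear algebra_simps)

lemma loop_cocycle_jacobi:
  "loop_cocycle f (loop_lie g h) = loop_cocycle (loop_lie f g) h + loop_cocycle g (loop_lie f h)"
proof (rule additive_poly_mapping_ext[where F = "\<lambda>f. loop_cocycle f (loop_lie g h)"])
  fix k x
  show "loop_cocycle (single k x) (loop_lie g h) =
    loop_cocycle (loop_lie (single k x) g) h + loop_cocycle g (loop_lie (single k x) h)"
  proof (rule additive_poly_mapping_ext[where F = "\<lambda>g. loop_cocycle (single k x) (loop_lie g h)"])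
    fix l y
    show "loop_cocycle (single k x) (loop_lie (single l y) h) =
      loop_cocycle (loop_lie (single k x) (single l y)) h
        + loop_cocycle (single l y) (loop_lie (single k x) h)"
    proof (rule additive_poly_mapping_ext[where F = "\<lambda>h. loop_cocycle (single k x) (loop_lie (single l y) h)"])
      fix m z
      have "killing y (lie x z) = - killing (lie x y) z"
        by (simp add: lie_skew[of x y] killing_invariant)
      moreover have "killing x (lie y z) = killing (lie x y) z"
        by (simp add: killing_invariant)
      ultimately show "loop_cocycle (single k x) (loop_lie (single l y) (single m z)) =
        loop_cocycle (loop_lie (single k x) (single l y)) (single m z)
          + loop_cocycle (single l y) (loop_lie (single k x) (single m z))"
        by (simp add: loop_lie_single loop_cocycle_single algebra_simps)
    qed (simp_all add: loop_lie_bilinear loop_cocycle_bilinear algebra_simps)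
  qed (simp_all add: loop_lie_bilinear loop_cocycle_bilinear algebra_simps)
qed (simp_all add: loop_lie_bilinear loop_cocycle_bilinear algebra_simps)

lemma loop_deriv_lie: "loop_deriv (loop_lie f g) = loop_lie (loop_deriv f) g + loop_lie f (loop_deriv g)"
proof (rule additive_poly_mapping_ext[where F = "\<lambda>f. loop_deriv (loop_lie f g)"])
  fix k x
  show "loop_deriv (loop_lie (single k x) g) =
    loop_lie (loop_deriv (single k x)) g + loop_lie (single k x) (loop_deriv g)"
    by (rule additive_poly_mapping_ext[where F = "\<lambda>g. loop_deriv (loop_lie (single k x) g)"])
      (simp_all add: loop_lie_bilinear loop_deriv_simps loop_lie_single algebra_simps
        flip: single_add)
qed (simp_all add: loop_lie_bilinear loop_deriv_simps algebra_simps)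

lemma loop_cocycle_deriv: "loop_cocycle (loop_deriv f) g + loop_cocycle f (loop_deriv g) = 0"
proof (rule additive_poly_mapping_ext[where F = "\<lambda>f. loop_cocycle (loop_deriv f) g + loop_cocycle f (loop_deriv g)"])
  fix k x
  show "loop_cocycle (loop_deriv (single k x)) g + loop_cocycle (single k x) (loop_deriv g) = 0"
  proof (rule additive_poly_mapping_ext[where F = "\<lambda>g. loop_cocycle (loop_deriv (single k x)) g + loop_cocycle (single k x) (loop_deriv g)"])
    fix l y
    show "loop_cocycle (loop_deriv (single k x)) (single l y) +
        loop_cocycle (single k x) (loop_deriv (single l y)) = 0"
      by (simp add: loop_deriv_simps loop_cocycle_single add_eq_0_iff flip: distrib_right)
  qed (simp_all add: loop_deriv_simps loop_cocycle_bilinear algebra_simps)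
qed (simp_all add: loop_deriv_simps loop_cocycle_bilinear algebra_simps)

lemma loop_lie_diff:
  "loop_lie f (g - h) = loop_lie f g - loop_lie f h" "loop_lie (f - g) h = loop_lie f h - loop_lie g h"
  using loop_lie_bilinear(2)[of f "g - h" h] loop_lie_bilinear(1)[of "f - g" g h]
  by (simp_all add: eq_diff_eq)

lemma loop_cocycle_diff:
  "loop_cocycle f (g - h) = loop_cocycle f g - loop_cocycle f h"
  "loop_cocycle (f - g) h = loop_cocycle f h - loop_cocycle g h"
  using loop_cocycle_bilinear(2)[of f "g - h" h] loop_cocycle_bilinear(1)[of "f - g" g h]
  by (simp_all add: eq_diff_eq)

lemma loop_deriv_diff: "loop_deriv (f - g) = loop_deriv f - loop_deriv g"
  using loop_deriv_simps(1)[of "f - g" g] by (simp add: eq_diff_eq)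

lemma aff_jacobi: "aff_lie x (aff_lie y z) = aff_lie (aff_lie x y) z + aff_lie y (aff_lie x z)"
proof -
  obtain f a a' g b b' h c c' where "x = (f, a, a')" "y = (g, b, b')" "z = (h, c, c')"
    by (metis prod_cases3)
  moreover have "loop_cocycle f (loop_deriv h) = - loop_cocycle (loop_deriv f) h"
    "loop_cocycle f (loop_deriv g) = - loop_cocycle (loop_deriv f) g"
    "loop_cocycle g (loop_deriv h) = - loop_cocycle (loop_deriv g) h"
    using loop_cocycle_deriv[of f h] loop_cocycle_deriv[of f g] loop_cocycle_deriv[of g h]
    by (simp_all add: eq_neg_iff_add_eq_0 add.commute)
  ultimately show ?thesis
    using loop_cocycle_skew[of g "loop_deriv f"]
    by (simp add: loop_lie_bilinear loop_cocycle_bilinear loop_lie_diff loop_cocycle_diff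
        loop_deriv_simps loop_deriv_diff loop_deriv_lie loop_scale_simps loop_jacobi[of f]
        loop_cocycle_jacobi[of f] loop_lie_skew[of g "loop_deriv f"]
        algebra_simps)
qed

sublocale aff: lie_algebra aff_scale aff_lie
proof -
  interpret aff: vector_space aff_scale by (rule aff_vector_space)
  have skew: "aff_lie x y = - aff_lie y x" for x y
    using loop_lie_skew[of "fst x" "fst y"] loop_cocycle_skew[of "fst x" "fst y"]
    by (cases x; cases y) simp
  have self: "aff_lie x x = 0" for x
  proof -
    have "aff_scale 2 (aff_lie x x) = aff_lie x x + aff_lie x x"
      using aff.scale_left_distrib[of 1 1] by simp
    also have "\<dots> = 0" by (subst skew) simp
    finally show ?thesis by simp
  qed
  show "lie_algebra aff_scale aff_lie"
  proof
    fix x y z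
    show "aff_lie x (aff_lie y z) + aff_lie y (aff_lie z x) + aff_lie z (aff_lie x y) = 0"
    proof -
      have "aff_lie y (aff_lie z x) = - aff_lie y (aff_lie x z)"
        using aff_bilinear(2)[of y "aff_lie z x" "aff_lie x z"] aff_bilinear(4)[of y 0 0]
        by (simp add: skew[of z x] eq_neg_iff_add_eq_0)
      moreover have "aff_lie z (aff_lie x y) = - aff_lie (aff_lie x y) z"
        by (rule skew)
      ultimately show ?thesis
        by (simp add: aff_jacobi[of x y z])
    qed
  qed (simp_all add: aff_bilinear self)
qed

text \<open>In the following, \<open>H\<close> is the Cartan subalgebra and \<open>Np\<close> the positive part of a
  triangular decomposition of the finite-dimensional Lie algebra.\<close>

definition aff_cartan :: "'a set \<Rightarrow> 'a affine set" where
  "aff_cartan H = {(single 0 h, a, b) | h a b. h \<in> H}"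

definition aff_pos :: "'a set \<Rightarrow> 'a affine set" where
  "aff_pos Np = aff.span ({(single 0 x, 0, 0) | x. x \<in> Np} \<union> {(single k x, 0, 0) | k x. k > 0})"

definition aff_pos_roots :: "'a set \<Rightarrow> 'a set \<Rightarrow> ('a affine \<Rightarrow> complex) set" where
  "aff_pos_roots H Np =
     {\<alpha> \<in> aff.roots (aff_cartan H). aff.root_space (aff_cartan H) \<alpha> \<inter> aff_pos Np \<noteq> {0}}"

definition delta :: "'a set \<Rightarrow> 'a affine \<Rightarrow> complex" where
  "delta H = (\<lambda>(f, a, b). if (f, a, b) \<in> aff_cartan H then b else 0)"

definition aff_ideals :: "'a set \<Rightarrow> 'a set \<Rightarrow> 'a affine set set" where
  "aff_ideals H Np = aff.borel_ideals (aff_cartan H) (aff_pos Np)"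

definition supp :: "'a set \<Rightarrow> 'a set \<Rightarrow> 'a affine set \<Rightarrow> ('a affine \<Rightarrow> complex) set" where
  "supp H Np I = {\<alpha> \<in> aff_pos_roots H Np. I \<inter> aff.root_space (aff_cartan H) \<alpha> \<noteq> {0}}"

definition has_level :: "'a set \<Rightarrow> 'a set \<Rightarrow> 'a affine set \<Rightarrow> nat \<Rightarrow> bool" where
  "has_level H Np I l \<longleftrightarrow>
     0 < l \<and> (\<lambda>x. of_nat l * delta H x) \<in> supp H Np I \<and>
     (\<forall>k. 0 < k \<and> k < l \<longrightarrow> (\<lambda>x. of_nat k * delta H x) \<notin> supp H Np I)"

definition supports_of_level :: "'a set \<Rightarrow> 'a set \<Rightarrow> nat \<Rightarrow> ('a affine \<Rightarrow> complex) set set" where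
  "supports_of_level H Np l =
     {supp H Np I | I. I \<in> aff_ideals H Np \<and> I \<noteq> {0} \<and> has_level H Np I l}"

end

end

theory Submission
  imports Defs
begin

text \<open>
  Let \<open>\<ii>\<close> be an ideal of level \<open>l\<close> and \<open>J\<^sub>k = {y \<in> \<g>. y \<otimes> t^k \<in> \<ii>}\<close>.  Bracketing a root vector of \<open>J\<^sub>k\<close> with
  one of the opposite root gives a nonzero element of the Cartan subalgebra, so \<open>\<alpha> + k \<delta>\<close> lies in the
  support only if \<open>k \<ge> l - 1\<close> (\<open>\<alpha>\<close> positive) or \<open>k \<ge> l\<close> (\<open>\<alpha>\<close> negative).  On the other hand, a
  nonzero \<open>h \<in> J\<^sub>l \<inter> \<h>\<close> produces all root vectors \<open>\<alpha> + k \<delta>\<close> with \<open>k \<ge> l + 1\<close> (\<open>\<alpha>\<close> positive) or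
  \<open>k \<ge> l + 2\<close> (\<open>\<alpha>\<close> negative): directly if \<open>\<alpha> h \<noteq> 0\<close>, and otherwise because simplicity of \<open>\<g>\<close> makes \<open>\<alpha>\<close>
  a sum of two roots that do not vanish at \<open>h\<close>.  So the support is determined by its positive roots
  in the degrees \<open>l - 1\<close>, \<open>l\<close> and its negative roots in the degrees \<open>l\<close>, \<open>l + 1\<close>.  The former are given by
  the ideals \<open>J\<^sub>k \<inter> \<n>\<^sub>+\<close> of \<open>\<b>\<close>, the latter by the annihilators of \<open>J\<^sub>k\<close> in \<open>\<n>\<^sub>+\<close> for the Killing form,
  which are ideals of \<open>\<b>\<close> as well.
\<close>

section \<open>Counting and linear algebra\<close>

text \<open>Choosing one preimage for each value of \<open>\<Phi>\<close> factors \<open>S\<close>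
  through \<open>\<Phi>\<close> on \<open>L\<close>. It serves with \<open>S\<close> the support and
  \<open>\<Phi>\<close> a quadruple of ideals of the Borel subalgebra.\<close>

lemma card_image_le_if_determined:
  assumes "finite B" "\<Phi> ` L \<subseteq> B"
    and "\<And>x y. x \<in> L \<Longrightarrow> y \<in> L \<Longrightarrow> \<Phi> x = \<Phi> y \<Longrightarrow> S x = S y"
  shows "finite (S ` L) \<and> card (S ` L) \<le> card B"
proof -
  have "S x = S (inv_into L \<Phi> (\<Phi> x))" if "x \<in> L" for x
    using assms(3)[of x "inv_into L \<Phi> (\<Phi> x)"] that by (simp add: inv_into_into f_inv_into_f)
  then have "S ` L \<subseteq> (\<lambda>b. S (inv_into L \<Phi> b)) ` B" using assms(2) by blast
  then show ?thesis using assms(1) finite_surj surj_card_le by metis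
qed

text \<open>Induction on \<open>F\<close>: a new functional \<open>g\<close> that vanished on the
  common kernel of the others would be a combination of them, so its value can be adjusted
  independently. Linearity is asked on \<open>H\<close> only, because elements of
  \<open>dual H\<close> are extended by 0.\<close>

lemma (in vector_space) functionals_separated:
  fixes F :: "('b \<Rightarrow> 'a) set"
  assumes "subspace H" "finite F"
    and "\<And>f x y. f \<in> F \<Longrightarrow> x \<in> H \<Longrightarrow> y \<in> H \<Longrightarrow> f (x + y) = f x + f y"
    and "\<And>f c x. f \<in> F \<Longrightarrow> x \<in> H \<Longrightarrow> f (c *s x) = c * f x"
    and "\<And>c. (\<And>x. x \<in> H \<Longrightarrow> (\<Sum>f\<in>F. c f * f x) = 0) \<Longrightarrow> \<forall>f\<in>F. c f = 0"
  shows "\<exists>h\<in>H. \<forall>f\<in>F. f h = t f"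
  using assms(2-)
proof (induction F arbitrary: t rule: finite_induct)
  case empty
  then show ?case using assms(1) subspace_0 by blast
next
  case (insert g F)
  have indep: "\<forall>f\<in>F. c f = 0" if "\<And>x. x \<in> H \<Longrightarrow> (\<Sum>f\<in>F. c f * f x) = 0" for c
  proof -
    have "(\<Sum>f\<in>insert g F. (c(g := 0)) f * f x) = 0" if "x \<in> H" for x
    proof -
      have "(\<Sum>f\<in>F. (c(g := 0)) f * f x) = (\<Sum>f\<in>F. c f * f x)"
        using insert.hyps by (intro sum.cong) auto
      then show ?thesis
        using insert.hyps \<open>\<And>x. x \<in> H \<Longrightarrow> (\<Sum>f\<in>F. c f * f x) = 0\<close>[OF that] by simp
    qed
    from insert.prems(3)[OF this] insert.hyps show ?thesis by (auto split: if_splits)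
  qed
  have IH: "\<exists>h\<in>H. \<forall>f\<in>F. f h = s f" for s
    by (rule insert.IH) (use insert.prems indep in auto)
  note add = insert.prems(1) and scale = insert.prems(2)
  have sumF: "f (\<Sum>i\<in>A. c i *s x i) = (\<Sum>i\<in>A. c i * f (x i))"
    if "f \<in> insert g F" "\<And>i. i \<in> A \<Longrightarrow> x i \<in> H"
    for f A and c :: "('b \<Rightarrow> 'a) \<Rightarrow> 'a" and x
    using that(2)
  proof (induction A rule: infinite_finite_induct)
    case (insert i A)
    then have "(\<Sum>i\<in>A. c i *s x i) \<in> H"
      using assms(1) by (intro subspace_sum subspace_scale) auto
    moreover have "c i *s x i \<in> H" using insert.prems assms(1) by (simp add: subspace_scale)
    ultimately show ?case
      using insert add[of f "c i *s x i" "\<Sum>i\<in>A. c i *s x i"] scale[of f "x i" "c i"] that(1)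
      by simp
  next
    case (infinite A)
    show ?case using scale[OF that(1) subspace_0[OF assms(1)], of 0] infinite by simp
  next
    case empty
    show ?case using scale[OF that(1) subspace_0[OF assms(1)], of 0] by simp
  qed
  \<comment> \<open>The \<open>d i\<close> are vectors dual to the functionals in
    \<open>F\<close>.\<close>
  obtain d where d: "\<And>i. d i \<in> H" "\<And>i f. f \<in> F \<Longrightarrow> f (d i) = (if f = i then 1 else 0)"
    using IH[of "\<lambda>f. if f = i then 1 else 0" for i] by metis
  have neg: "f (- x) = - f x" if "f \<in> insert g F" "x \<in> H" for f x
    using insert.prems(2)[OF that, of "-1"] by simp
  have "\<exists>k\<in>H. (\<forall>f\<in>F. f k = 0) \<and> g k \<noteq> 0"
  proof (rule ccontr)
    assume no: "\<not> ?thesis"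
    \<comment> \<open>If \<open>g\<close> vanishes on the common kernel of \<open>F\<close>, then
      \<open>g\<close> is the sum of the \<open>g (d f) * f\<close> on \<open>H\<close>;
      \<open>c\<close> holds the coefficients of this forbidden relation.\<close>
    define c where "c = (\<lambda>f. if f = g then 1 else - g (d f))"
    have "(\<Sum>f\<in>insert g F. c f * f x) = 0" if x: "x \<in> H" for x
    proof -
      \<comment> \<open>\<open>s\<close> is the projection of \<open>x\<close> onto the span of the
        \<open>d i\<close>, so \<open>x + - s\<close> lies in the common kernel of
        \<open>F\<close>.\<close>
      define s where "s = (\<Sum>i\<in>F. i x *s d i)"
      have s: "s \<in> H" unfolding s_def using assms(1) d by (intro subspace_sum subspace_scale)
      have m: "x + - s \<in> H" using s x assms(1) by (metis subspace_add subspace_neg)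
      have "f (x + - s) = 0" if "f \<in> F" for f
      proof -
        have "f s = f x"
          unfolding s_def using sumF[of f F d "\<lambda>i. i x"] that d(1) insert.hyps
          by (simp add: d(2)[OF that] if_distrib[of "(*) _"] cong: if_cong)
        then show ?thesis using insert.prems(1)[of f x "- s"] that x s neg[of f s] assms(1)
          by (simp add: subspace_neg)
      qed
      with no m have "g (x + - s) = 0" by blast
      then have "g x = g s"
        using insert.prems(1)[of g x "- s"] x s neg[of g s] assms(1) by (simp add: subspace_neg)
      also have "g s = (\<Sum>i\<in>F. i x * g (d i))"
        unfolding s_def using sumF[of g F d "\<lambda>i. i x"] d by simp
      finally have "g x = (\<Sum>i\<in>F. i x * g (d i))" .
      moreover have "(\<Sum>f\<in>F. c f * f x) = - (\<Sum>i\<in>F. i x * g (d i))"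
        unfolding sum_negf[symmetric] using insert.hyps
        by (intro sum.cong) (auto simp: c_def mult.commute)
      ultimately show ?thesis using insert.hyps by (simp add: c_def)
    qed
    from insert.prems(3)[OF this] show False by (simp add: c_def)
  qed
  then obtain k where k: "k \<in> H" "\<And>f. f \<in> F \<Longrightarrow> f k = 0" "g k \<noteq> 0" by blast
  obtain h where h: "h \<in> H" "\<And>f. f \<in> F \<Longrightarrow> f h = t f" using IH by blast
  \<comment> \<open>Adding a multiple of \<open>k\<close> corrects the value of \<open>g\<close> and
    leaves the values of \<open>F\<close> alone.\<close>
  define r where "r = (t g - g h) / g k"
  have "h + r *s k \<in> H" using h k assms(1) by (simp add: subspace_add subspace_scale)
  moreover have "f (h + r *s k) = t f" if "f \<in> insert g F" for f
    using insert.prems(1)[OF that, of h "r *s k"] insert.prems(2)[OF that, of k r] h k that assms(1)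
    by (auto simp: subspace_scale r_def)
  ultimately show ?case by blast
qed

section \<open>Weight vectors, the Killing form and traces\<close>

context finite_dimensional_lie_algebra
begin

lemma lie_sum_right: "lie h (\<Sum>i\<in>A. f i) = (\<Sum>i\<in>A. lie h (f i))"
  by (induction A rule: infinite_finite_induct) simp_all

lemma killing_sum_right: "killing h (\<Sum>i\<in>A. f i) = (\<Sum>i\<in>A. killing h (f i))"
  by (induction A rule: infinite_finite_induct) simp_all

text \<open>If \<open>h\<close> separates \<alpha> from \<beta>, then \<open>lie h\<close> minus the
  scalar \<open>\<beta> h\<close> preserves \<open>I\<close>, removes the \<beta>-component and
  multiplies the \<alpha>-component by a nonzero scalar. The induction hypothesis applies to the
  rescaled components; the \<beta>-component is what is left after subtracting the others.\<close>

lemma weight_components_in: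
  assumes "subspace I" and inv: "\<And>h x. h \<in> H \<Longrightarrow> x \<in> I \<Longrightarrow> lie h x \<in> I"
    and "finite A" and "\<And>\<alpha>. \<alpha> \<in> A \<Longrightarrow> x \<alpha> \<in> root_space H \<alpha>"
    and "\<And>\<alpha> \<beta>. \<alpha> \<in> A \<Longrightarrow> \<beta> \<in> A \<Longrightarrow> \<alpha> \<noteq> \<beta> \<Longrightarrow> \<exists>h\<in>H. \<alpha> h \<noteq> \<beta> h"
    and "(\<Sum>\<alpha>\<in>A. x \<alpha>) \<in> I"
  shows "\<forall>\<alpha>\<in>A. x \<alpha> \<in> I"
  using assms(3-)
proof (induction A arbitrary: x rule: finite_induct)
  case (insert \<beta> A)
  let ?s = "\<Sum>\<alpha>\<in>insert \<beta> A. x \<alpha>"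
  have "x \<alpha> \<in> I" if \<alpha>: "\<alpha> \<in> A" for \<alpha>
  proof -
    obtain h where h: "h \<in> H" "\<alpha> h \<noteq> \<beta> h"
      using insert.prems(2)[of \<alpha> \<beta>] \<alpha> insert.hyps by auto
    have wt: "lie h (x \<gamma>) = \<gamma> h *s x \<gamma>" if "\<gamma> \<in> insert \<beta> A" for \<gamma>
      using insert.prems(1)[OF that] h by (simp add: root_space_def)
    have "lie h ?s - \<beta> h *s ?s = (\<Sum>\<gamma>\<in>A. (\<gamma> h - \<beta> h) *s x \<gamma>)"
    proof -
      have "(\<Sum>\<gamma>\<in>A. lie h (x \<gamma>)) = (\<Sum>\<gamma>\<in>A. \<gamma> h *s x \<gamma>)"
        using wt by (intro sum.cong) auto
      then show ?thesis
        using insert.hyps wt[of \<beta>]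
        by (simp add: lie_sum_right scale_right_distrib scale_left_diff_distrib sum_subtractf
            scale_sum_right)
    qed
    moreover have "lie h ?s - \<beta> h *s ?s \<in> I"
      using insert.prems(3) h inv assms(1) by (simp add: subspace_diff subspace_scale)
    ultimately have "(\<Sum>\<gamma>\<in>A. (\<gamma> h - \<beta> h) *s x \<gamma>) \<in> I" by simp
    then have "\<forall>\<gamma>\<in>A. (\<gamma> h - \<beta> h) *s x \<gamma> \<in> I"
      using insert.prems(1,2)
      by (intro insert.IH) (auto simp: root_space_def mult.commute)
    then have "(\<alpha> h - \<beta> h) *s x \<alpha> \<in> I" using \<alpha> by blast
    then have "(1 / (\<alpha> h - \<beta> h)) *s (\<alpha> h - \<beta> h) *s x \<alpha> \<in> I"
      using assms(1) by (simp only: subspace_scale)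
    then show ?thesis using h by simp
  qed
  moreover from this have "(\<Sum>\<alpha>\<in>A. x \<alpha>) \<in> I"
    using assms(1) by (intro subspace_sum) auto
  from subspace_diff[OF assms(1) insert.prems(3) this]
  have "x \<beta> \<in> I" using insert.hyps by simp
  ultimately show ?case by blast
qed simp

lemma subspace_root_space: "subspace (root_space H \<alpha>)"
  by (auto simp: subspace_def root_space_def scale_right_distrib mult.commute)

lemma subspace_centralizer: "subspace {w. lie z w = 0}"
  by (auto simp: subspace_def)

lemma subspace_killing_orthogonal: "subspace {w. killing z w = 0}"
  by (auto simp: subspace_def)

lemma lie_root_space:
  assumes "x \<in> root_space H \<alpha>" "y \<in> root_space H \<beta>"
  shows "lie x y \<in> root_space H (\<lambda>h. \<alpha> h + \<beta> h)"
proof -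
  have "lie h (lie x y) = lie (lie h x) y + lie x (lie h y)" for h
    by (simp add: lie_lie)
  then show ?thesis using assms by (auto simp: root_space_def scale_left_distrib)
qed

lemma root_space_cong:
  assumes "\<And>h. h \<in> H \<Longrightarrow> \<alpha> h = \<beta> h"
  shows "root_space H \<alpha> = root_space H \<beta>"
  using assms by (auto simp: root_space_def)

lemma dual_eqI:
  assumes "\<alpha> \<in> dual H" "\<beta> \<in> dual H" "\<And>h. h \<in> H \<Longrightarrow> \<alpha> h = \<beta> h"
  shows "\<alpha> = \<beta>"
proof
  fix x
  show "\<alpha> x = \<beta> x" using assms by (cases "x \<in> H") (auto simp: dual_def)
qed

text \<open>Invariance moves \<open>h\<close> from one argument to the other, where it acts by the
  scalars \<open>\<alpha> h\<close> and \<open>- \<beta> h\<close>.\<close>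

lemma killing_root_space_eq_0:
  assumes "x \<in> root_space H \<alpha>" "y \<in> root_space H \<beta>" "h \<in> H" "\<alpha> h + \<beta> h \<noteq> 0"
  shows "killing x y = 0"
proof -
  have "\<alpha> h * killing x y = killing (lie h x) y"
    using assms by (simp add: root_space_def)
  also have "\<dots> = - killing (lie x h) y" by (subst lie_skew) simp
  also have "\<dots> = - \<beta> h * killing x y"
    using assms by (simp add: killing_invariant root_space_def)
  finally have "(\<alpha> h + \<beta> h) * killing x y = 0" by (simp add: algebra_simps)
  then show ?thesis using assms by simp
qed

text \<open>For \<open>y\<close> in the opposite root space this says that \<open>lie x y\<close>
  represents the functional \<open>killing x y\<close> times \<alpha> on \<open>H\<close>.\<close>

lemma killing_lie_root_space:
  assumes "x \<in> root_space H \<alpha>" "h \<in> H"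
  shows "killing h (lie x y) = \<alpha> h * killing x y"
  using killing_invariant[of h x y] assms by (simp add: root_space_def)

lemma trace_sum: "trace (\<lambda>x. \<Sum>i\<in>A. f i x) = (\<Sum>i\<in>A. trace (f i))"
proof -
  have "trace (\<lambda>x. 0) = 0" using trace_scale[of 0 "\<lambda>x. 0"] by simp
  then show ?thesis
    by (induction A rule: infinite_finite_induct) (simp_all add: trace_add)
qed

text \<open>Every endomorphism is a sum of rank one maps \<open>x \<mapsto> \<phi> x *s v\<close>, whose trace \<open>\<phi> v\<close> in the
  chosen basis does not depend on that basis.\<close>

lemma trace_eq_sum_basis:
  assumes B: "finite B" "independent B" "span B = UNIV"
    and f: "Vector_Spaces.linear scale scale f"
  shows "trace f = (\<Sum>b\<in>B. representation B (f b) b)"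
proof -
  interpret f: Vector_Spaces.linear scale scale f by (rule f)
  obtain E where E: "E = extend_basis {}" "finite E" "independent E" "span E = UNIV"
    by (rule ex_basis)
  have rank1: "trace (\<lambda>x. representation B x b *s v) = representation B v b" for b v
  proof -
    have "representation B v b = representation B (\<Sum>e\<in>E. representation E v e *s e) b"
      using sum_representation_eq[of E v E] E by simp
    also have "\<dots> = (\<Sum>e\<in>E. representation E v e * representation B e b)"
      using B by (simp add: representation_sum representation_scale)
    finally show ?thesis
      using B E(2-) by (simp add: trace_def representation_scale mult.commute[of "representation E v _"]
          flip: E(1))
  qed
  have "f x = (\<Sum>b\<in>B. representation B x b *s f b)" for x
  proof -
    have "f x = f (\<Sum>b\<in>B. representation B x b *s b)"
      using sum_representation_eq[of B x B] B by simp
    then show ?thesis by (simp add: f.sum f.scale)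
  qed
  then have "f = (\<lambda>x. \<Sum>b\<in>B. representation B x b *s f b)" by (rule ext)
  then have "trace f = trace (\<lambda>x. \<Sum>b\<in>B. representation B x b *s f b)" by (rule arg_cong)
  then show ?thesis by (simp add: trace_sum rank1)
qed

end

section \<open>Weight decomposition\<close>

text \<open>The base, which a triangular decomposition only asserts to exist, becomes a parameter,
  so that positive and negative roots can be named.\<close>

locale triangular_simple_lie_algebra = simple_lie_algebra +
  fixes Nm H Np :: "'a set" and \<Pi> :: "('a \<Rightarrow> complex) set"
  assumes cartan: "cartan_subalgebra H"
    and base: "root_base H \<Pi>"
    and Np_eq: "Np = span (\<Union>\<alpha>\<in>{\<alpha>\<in>roots H. \<alpha> \<in> nat_cone \<Pi>}. root_space H \<alpha>)"
    and Nm_eq: "Nm = span (\<Union>\<alpha>\<in>{\<alpha>\<in>roots H. (\<lambda>x. - \<alpha> x) \<in> nat_cone \<Pi>}. root_space H \<alpha>)"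
    and triangular: "bij_betw (\<lambda>(u, v, w). u + v + w) (Nm \<times> H \<times> Np) UNIV"
begin

abbreviation g :: "('a \<Rightarrow> complex) \<Rightarrow> 'a set" where
  "g \<equiv> root_space H"

definition pos_roots :: "('a \<Rightarrow> complex) set" where
  "pos_roots = {\<alpha>\<in>roots H. \<alpha> \<in> nat_cone \<Pi>}"

definition neg_roots :: "('a \<Rightarrow> complex) set" where
  "neg_roots = {\<alpha>\<in>roots H. (\<lambda>x. - \<alpha> x) \<in> nat_cone \<Pi>}"

abbreviation weights :: "('a \<Rightarrow> complex) set" where
  "weights \<equiv> insert (\<lambda>_. 0) (roots H)"

lemma roots_split: "roots H = pos_roots \<union> neg_roots"
  using base by (auto simp: root_base_def pos_roots_def neg_roots_def)

lemma subspace_H: "subspace H" and lie_H: "x \<in> H \<Longrightarrow> y \<in> H \<Longrightarrow> lie x y \<in> H"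
  using cartan by (auto simp: cartan_subalgebra_def subalgebra_def)

lemma subspace_Np: "subspace Np" and subspace_Nm: "subspace Nm"
  by (simp_all add: Np_eq Nm_eq)

lemma root_space_pos: "\<alpha> \<in> pos_roots \<Longrightarrow> g \<alpha> \<subseteq> Np"
  unfolding Np_eq pos_roots_def by (auto intro: span_base)

lemma root_space_neg: "\<alpha> \<in> neg_roots \<Longrightarrow> g \<alpha> \<subseteq> Nm"
  unfolding Nm_eq neg_roots_def by (auto intro: span_base)

lemma triangular_unique:
  assumes "u \<in> Nm" "v \<in> H" "w \<in> Np" "u' \<in> Nm" "v' \<in> H" "w' \<in> Np" "u + v + w = u' + v' + w'"
  shows "u = u'" "v = v'" "w = w'"
proof -
  have "inj_on (\<lambda>(u, v, w). u + v + w) (Nm \<times> H \<times> Np)"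
    using triangular by (simp add: bij_betw_def)
  from inj_onD[OF this, of "(u, v, w)" "(u', v', w')"] assms
  show "u = u'" "v = v'" "w = w'" by auto
qed

lemma Np_Nm_disjoint: "x \<in> Np \<Longrightarrow> x \<in> Nm \<Longrightarrow> x = 0"
  using triangular_unique(1)[of x 0 0 0 0 x] subspace_0[OF subspace_H] subspace_0[OF subspace_Np]
    subspace_0[OF subspace_Nm] by auto

lemma Np_H_disjoint: "x \<in> Np \<Longrightarrow> x \<in> H \<Longrightarrow> x = 0"
  using triangular_unique(2)[of 0 x 0 0 0 x] subspace_0[OF subspace_H] subspace_0[OF subspace_Np]
    subspace_0[OF subspace_Nm] by auto

lemma rootsD:
  assumes "\<alpha> \<in> roots H"
  shows "\<alpha> \<in> dual H" "\<exists>h\<in>H. \<alpha> h \<noteq> 0" "\<exists>x\<in>g \<alpha>. x \<noteq> 0"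
proof -
  show d: "\<alpha> \<in> dual H" using assms by (simp add: roots_def)
  show "\<exists>h\<in>H. \<alpha> h \<noteq> 0"
    using dual_eqI[OF d, of "\<lambda>_. 0"] assms by (auto simp: roots_def dual_def)
  show "\<exists>x\<in>g \<alpha>. x \<noteq> 0"
    using assms subspace_0[OF subspace_root_space] by (auto simp: roots_def)
qed

lemma rootsI: "\<alpha> \<in> dual H \<Longrightarrow> x \<in> g \<alpha> \<Longrightarrow> x \<noteq> 0 \<Longrightarrow> \<alpha> \<in> weights"
  by (auto simp: roots_def)

lemma zero_in_dual: "(\<lambda>_. 0) \<in> dual H"
  by (simp add: dual_def)

lemma weights_dual: "\<alpha> \<in> weights \<Longrightarrow> \<alpha> \<in> dual H"
  using rootsD zero_in_dual by auto

lemma dual_lin_comb: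
  "\<alpha> \<in> dual H \<Longrightarrow> \<beta> \<in> dual H \<Longrightarrow> (\<lambda>h. a * \<alpha> h + b * \<beta> h) \<in> dual H"
  by (simp add: dual_def algebra_simps)

lemma dual_add: "\<alpha> \<in> dual H \<Longrightarrow> \<beta> \<in> dual H \<Longrightarrow> (\<lambda>h. \<alpha> h + \<beta> h) \<in> dual H"
  using dual_lin_comb[of \<alpha> \<beta> 1 1] by simp

lemma dual_uminus: "\<alpha> \<in> dual H \<Longrightarrow> (\<lambda>h. - \<alpha> h) \<in> dual H"
  using dual_lin_comb[of \<alpha> \<alpha> "-1" 0] by simp

text \<open>The root space of a common root would lie in the intersection of \<open>Np\<close> and
  \<open>Nm\<close>, which is 0.\<close>

lemma pos_neg_disjoint: "\<alpha> \<in> pos_roots \<Longrightarrow> \<alpha> \<notin> neg_roots"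
  using root_space_pos[of \<alpha>] root_space_neg[of \<alpha>] Np_Nm_disjoint rootsD(3)[of \<alpha>] roots_split
  by blast

lemma nat_cone_add:
  assumes "\<alpha> \<in> nat_cone \<Pi>" "\<beta> \<in> nat_cone \<Pi>"
  shows "(\<lambda>x. \<alpha> x + \<beta> x) \<in> nat_cone \<Pi>"
proof -
  obtain m n :: "('a \<Rightarrow> complex) \<Rightarrow> nat" where
    "\<alpha> = (\<lambda>x. \<Sum>\<beta>\<in>\<Pi>. of_nat (m \<beta>) * \<beta> x)" "\<beta> = (\<lambda>x. \<Sum>\<beta>\<in>\<Pi>. of_nat (n \<beta>) * \<beta> x)"
    using assms by (auto simp: nat_cone_def)
  then have "(\<lambda>x. \<alpha> x + \<beta> x) = (\<lambda>x. \<Sum>\<beta>\<in>\<Pi>. of_nat (m \<beta> + n \<beta>) * \<beta> x)"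
    by (intro ext) (simp add: sum.distrib distrib_right)
  then show ?thesis unfolding nat_cone_def by (intro CollectI exI[of _ "\<lambda>\<beta>. m \<beta> + n \<beta>"])
qed

text \<open>If the bracket is nonzero, the sum of the two roots is a weight in the cone. It is not
  0, as otherwise \<beta> would be both positive and negative.\<close>

lemma pos_roots_add:
  assumes "\<alpha> \<in> pos_roots" "\<beta> \<in> pos_roots" "x \<in> g \<alpha>" "y \<in> g \<beta>"
  shows "lie x y \<in> Np"
proof (cases "lie x y = 0")
  case False
  let ?\<gamma> = "\<lambda>h. \<alpha> h + \<beta> h"
  have dual: "?\<gamma> \<in> dual H" using assms rootsD roots_split by (intro dual_add) auto
  have cone: "?\<gamma> \<in> nat_cone \<Pi>" using assms by (intro nat_cone_add) (auto simp: pos_roots_def)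
  have "?\<gamma> \<in> weights" using rootsI[OF dual lie_root_space[OF assms(3,4)] False] .
  moreover have "?\<gamma> \<noteq> (\<lambda>_. 0)"
  proof
    assume "?\<gamma> = (\<lambda>_. 0)"
    then have "(\<lambda>x. - \<beta> x) = \<alpha>" by (auto simp: fun_eq_iff eq_neg_iff_add_eq_0 neg_eq_iff_add_eq_0 add.commute)
    then have "\<beta> \<in> neg_roots" using assms by (auto simp: pos_roots_def neg_roots_def)
    then show False using assms pos_neg_disjoint by blast
  qed
  ultimately have "?\<gamma> \<in> pos_roots" using cone by (auto simp: pos_roots_def)
  then show ?thesis using lie_root_space[OF assms(3,4)] root_space_pos by blast
qed (simp add: subspace_0[OF subspace_Np])

lemma ideal_UNIV_eq:
  assumes "subspace I" "\<And>x y. y \<in> I \<Longrightarrow> lie x y \<in> I" "x \<in> I" "x \<noteq> 0"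
  shows "I = UNIV"
  using simple[of I] assms by (auto simp: ideal_of_def)

text \<open>The center is an ideal, and it is proper because the algebra is not abelian.\<close>

lemma center_eq_0:
  assumes "\<And>x. lie z x = 0"
  shows "z = 0"
proof (rule ccontr)
  assume "z \<noteq> 0"
  moreover have "subspace {z. \<forall>x. lie z x = 0}" by (auto simp: subspace_def)
  moreover have "lie (lie x y) w = 0" if "\<forall>x. lie y x = 0" for x y w
    using that by (simp add: lie_lie)
  ultimately have "{z. \<forall>x. lie z x = 0} = UNIV"
    using assms by (intro ideal_UNIV_eq[of _ z]) auto
  then show False using nonabelian by blast
qed

lemma UNIV_induct:
  assumes "subspace S" "H \<subseteq> S" "\<And>\<alpha>. \<alpha> \<in> roots H \<Longrightarrow> g \<alpha> \<subseteq> S"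
  shows "x \<in> S"
proof -
  have "x \<in> (\<lambda>(u, v, w). u + v + w) ` (Nm \<times> H \<times> Np)"
    using triangular by (simp add: bij_betw_def)
  then obtain u v w where x: "x = u + v + w" "u \<in> Nm" "v \<in> H" "w \<in> Np" by auto
  have "Np \<subseteq> S" unfolding Np_eq by (rule span_minimal) (use assms in auto)
  moreover have "Nm \<subseteq> S" unfolding Nm_eq by (rule span_minimal) (use assms in auto)
  ultimately show ?thesis using x assms by (auto intro!: subspace_add)
qed

lemma lie_commutator_root_space:
  assumes "a \<in> H" "b \<in> H" "x \<in> g \<alpha>"
  shows "lie (lie a b) x = 0"
  using assms by (simp add: lie_lie root_space_def mult.commute)

text \<open>A nonzero last term of the lower central series beyond the first commutes with \<open>H\<close> and, lying
  in \<open>[H, H]\<close>, acts by zero on all root spaces.  So it is central.\<close>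

lemma H_abelian:
  assumes "x \<in> H" "y \<in> H"
  shows "lie x y = 0"
proof -
  have sub: "lower_central H n \<subseteq> H" for n
  proof (induction n)
    case (Suc n)
    then have "span {lie x y |x y. x \<in> H \<and> y \<in> lower_central H n} \<subseteq> H"
      using lie_H subspace_H by (intro span_minimal) auto
    then show ?case by (simp add: lie_product_def)
  qed simp
  have step: "lower_central H (Suc n) = {0}" if n: "lower_central H (Suc (Suc n)) = {0}" for n
  proof -
    have "z = 0" if z: "z \<in> lower_central H (Suc n)" for z
    proof (rule center_eq_0)
      fix x
      have "lie h z = 0" if "h \<in> H" for h
      proof -
        have "lie h z \<in> lower_central H (Suc (Suc n))"
          unfolding lower_central.simps(2)[of H "Suc n"] lie_product_def
          using z that by (intro span_base) blast
        then show ?thesis using n by blast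
      qed
      then have "lie z h = 0" if "h \<in> H" for h
        using that by (subst lie_skew) simp
      moreover have "lie z e = 0" if "\<alpha> \<in> roots H" "e \<in> g \<alpha>" for \<alpha> e
      proof -
        have "span {lie a b |a b. a \<in> H \<and> b \<in> lower_central H n} \<subseteq> {z. lie z e = 0}"
          using that sub[of n] lie_commutator_root_space
          by (intro span_minimal) (auto simp: subspace_def)
        then show ?thesis using z by (auto simp: lie_product_def)
      qed
      ultimately show "lie z x = 0"
        using UNIV_induct[OF subspace_centralizer, of z x] by auto
    qed
    moreover have "0 \<in> lower_central H (Suc n)" by (simp add: lie_product_def span_zero)
    ultimately show ?thesis by blast
  qed
  obtain n where "lower_central H n = {0}" using cartan by (auto simp: cartan_subalgebra_def nilpotent_def)
  then show ?thesis
  proof (cases n)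
    case 0
    then show ?thesis using \<open>lower_central H n = {0}\<close> assms by simp
  next
    case (Suc m)
    \<comment> \<open>Vanishing is carried down the series to index \<open>Suc 0\<close>, which is
      the derived algebra of \<open>H\<close>.\<close>
    have "lower_central H (Suc m) = {0} \<Longrightarrow> lower_central H (Suc 0) = {0}" for m
    proof (induction m)
      case (Suc m)
      from Suc.IH[OF step[OF Suc.prems]] show ?case .
    qed
    then have "lower_central H (Suc 0) = {0}" using \<open>lower_central H n = {0}\<close> Suc by blast
    moreover have "lie x y \<in> lower_central H (Suc 0)"
      unfolding lower_central.simps lie_product_def using assms by (intro span_base) blast
    ultimately show ?thesis by blast
  qed
qed

text \<open>One inclusion is commutativity of \<open>H\<close>; for the other, whatever commutes
  with \<open>H\<close> normalizes \<open>H\<close>, and \<open>H\<close> is its own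
  normalizer.\<close>

lemma root_space_0: "g (\<lambda>_. 0) = H"
proof
  show "H \<subseteq> g (\<lambda>_. 0)" using H_abelian by (auto simp: root_space_def)
  show "g (\<lambda>_. 0) \<subseteq> H"
  proof
    fix x assume "x \<in> g (\<lambda>_. 0)"
    then have "lie x h = 0" if "h \<in> H" for h
      using that by (subst lie_skew) (simp add: root_space_def)
    then have "x \<in> normalizer H" using subspace_0[OF subspace_H] by (simp add: normalizer_def)
    then show "x \<in> H" using cartan by (simp add: cartan_subalgebra_def)
  qed
qed

lemma UNIV_weight_induct:
  assumes "subspace S" "\<And>\<alpha>. \<alpha> \<in> weights \<Longrightarrow> g \<alpha> \<subseteq> S"
  shows "x \<in> S"
  using UNIV_induct[OF assms(1)] assms(2) root_space_0 by blast

text \<open>A maximal independent subset of the union of the weight spaces. This does not presuppose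
  finitely many roots, so it can be used to prove that.\<close>

lemma weight_basis:
  obtains B wt where "finite B" "independent B" "span B = UNIV"
    "\<And>b. b \<in> B \<Longrightarrow> wt b \<in> weights" "\<And>b. b \<in> B \<Longrightarrow> b \<in> g (wt b)"
proof -
  obtain B where B: "B \<subseteq> (\<Union>\<alpha>\<in>weights. g \<alpha>)" "independent B" "(\<Union>\<alpha>\<in>weights. g \<alpha>) \<subseteq> span B"
    using maximal_independent_subset by blast
  have "x \<in> span B" for x
    by (rule UNIV_weight_induct) (use B in auto)
  then have sp: "span B = UNIV" by auto
  moreover have "finite B"
    using finite_dimensional independent_span_bound B(2) by (metis subset_UNIV)
  moreover have "\<forall>b\<in>B. \<exists>\<alpha>. \<alpha> \<in> weights \<and> b \<in> g \<alpha>" using B by blast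
  then obtain wt where "\<forall>b\<in>B. wt b \<in> weights \<and> b \<in> g (wt b)" by metis
  ultimately show ?thesis using that[of B wt] B(2) by blast
qed

text \<open>Every root is the weight of a basis vector: comparing \<open>lie h x\<close> with
  \<open>\<alpha> h *s x\<close> coordinatewise would otherwise make all coordinates of a root
  vector \<open>x\<close> vanish.\<close>

lemma finite_roots: "finite (roots H)"
proof -
  obtain B wt where B: "finite B" "independent B" "span B = UNIV"
    and wt: "\<And>b. b \<in> B \<Longrightarrow> wt b \<in> weights" "\<And>b. b \<in> B \<Longrightarrow> b \<in> g (wt b)"
    by (rule weight_basis) blast
  have "roots H \<subseteq> wt ` B"
  proof
    fix \<alpha> assume \<alpha>: "\<alpha> \<in> roots H"
    then obtain x where x: "x \<in> g \<alpha>" "x \<noteq> 0" using rootsD by blast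
    define c where "c = representation B x"
    have xc: "x = (\<Sum>b\<in>B. c b *s b)"
      unfolding c_def using sum_representation_eq[of B x B] B by simp
    show "\<alpha> \<in> wt ` B"
    proof (rule ccontr)
      assume no: "\<alpha> \<notin> wt ` B"
      have "c b = 0" if b: "b \<in> B" for b
      proof -
        have "wt b \<noteq> \<alpha>" using no b by blast
        then obtain h where h: "h \<in> H" "wt b h \<noteq> \<alpha> h"
          using dual_eqI[of "wt b" H \<alpha>] weights_dual wt(1)[OF b] \<alpha> by blast
        have "0 = lie h x - \<alpha> h *s x" using x h by (simp add: root_space_def)
        also have "lie h x = (\<Sum>b\<in>B. c b *s (wt b h *s b))"
          unfolding xc lie_sum_right using wt(2) h by (intro sum.cong) (auto simp: root_space_def)
        also have "\<dots> - \<alpha> h *s x = (\<Sum>b\<in>B. ((wt b h - \<alpha> h) * c b) *s b)"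
          by (subst xc) (simp add: scale_sum_right scale_left_diff_distrib left_diff_distrib
              right_diff_distrib sum_subtractf mult.commute)
        finally have "(\<Sum>b\<in>B. ((wt b h - \<alpha> h) * c b) *s b) = 0" by simp
        from independentD[OF B(2) B(1) subset_refl this b] h show ?thesis by simp
      qed
      then show False using x xc by simp
    qed
  qed
  then show ?thesis using B finite_surj by blast
qed

lemma weight_decomposition:
  obtains f where "\<And>\<alpha>. \<alpha> \<in> weights \<Longrightarrow> f \<alpha> \<in> g \<alpha>" "x = (\<Sum>\<alpha>\<in>weights. f \<alpha>)"
proof -
  let ?S = "{x. \<exists>f. (\<forall>\<alpha>\<in>weights. f \<alpha> \<in> g \<alpha>) \<and> x = (\<Sum>\<alpha>\<in>weights. f \<alpha>)}"
  have "x \<in> ?S"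
  proof (rule UNIV_weight_induct)
    show "subspace ?S"
      unfolding subspace_def
    proof (intro conjI ballI allI)
      show "0 \<in> ?S"
        using subspace_0[OF subspace_root_space] by (auto intro!: exI[of _ "\<lambda>_. 0"])
      fix u v c assume "u \<in> ?S"
      then obtain p where p: "\<forall>\<alpha>\<in>weights. p \<alpha> \<in> g \<alpha>" "u = (\<Sum>\<alpha>\<in>weights. p \<alpha>)" by auto
      show "c *s u \<in> ?S"
        using p subspace_scale[OF subspace_root_space]
        by (auto simp: scale_sum_right intro!: exI[of _ "\<lambda>\<alpha>. c *s p \<alpha>"])
      assume "v \<in> ?S"
      then obtain q where q: "\<forall>\<alpha>\<in>weights. q \<alpha> \<in> g \<alpha>" "v = (\<Sum>\<alpha>\<in>weights. q \<alpha>)" by auto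
      show "u + v \<in> ?S"
        using p q subspace_add[OF subspace_root_space]
        by (auto simp: sum.distrib intro!: exI[of _ "\<lambda>\<alpha>. p \<alpha> + q \<alpha>"])
    qed
    fix \<alpha> assume "\<alpha> \<in> weights"
    then show "g \<alpha> \<subseteq> ?S"
      using finite_roots subspace_0[OF subspace_root_space]
      by (auto intro!: exI[of _ "\<lambda>\<beta>. if \<beta> = \<alpha> then _ else 0"] simp: sum.delta split: if_splits)
  qed
  then show ?thesis using that by auto
qed

lemma H_invariant_components:
  assumes "subspace I" "\<And>h x. h \<in> H \<Longrightarrow> x \<in> I \<Longrightarrow> lie h x \<in> I" "x \<in> I"
  obtains f where "\<And>\<alpha>. \<alpha> \<in> weights \<Longrightarrow> f \<alpha> \<in> g \<alpha> \<inter> I" "x = (\<Sum>\<alpha>\<in>weights. f \<alpha>)"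
proof -
  obtain f where f: "\<And>\<alpha>. \<alpha> \<in> weights \<Longrightarrow> f \<alpha> \<in> g \<alpha>" "x = (\<Sum>\<alpha>\<in>weights. f \<alpha>)"
    by (rule weight_decomposition[where x = x]) blast
  have "\<exists>h\<in>H. \<alpha> h \<noteq> \<beta> h" if "\<alpha> \<in> weights" "\<beta> \<in> weights" "\<alpha> \<noteq> \<beta>" for \<alpha> \<beta>
    using dual_eqI[of \<alpha> H \<beta>] weights_dual that by blast
  note sep = this
  have "\<forall>\<alpha>\<in>weights. f \<alpha> \<in> I"
    by (rule weight_components_in[OF assms(1,2) _ f(1) sep]) (use finite_roots f(2) assms(3) in simp_all)
  then show ?thesis using f that[of f] by blast
qed

text \<open>An element of \<open>H\<close> killed by all roots is central, hence 0.\<close>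

lemma root_nonvanishing:
  assumes "h \<in> H" "h \<noteq> 0"
  obtains \<alpha> where "\<alpha> \<in> roots H" "\<alpha> h \<noteq> 0"
proof -
  have "\<exists>\<alpha>\<in>roots H. \<alpha> h \<noteq> 0"
  proof (rule ccontr)
    assume no: "\<not> ?thesis"
    have "x \<in> {x. lie h x = 0}" for x
      by (rule UNIV_induct[OF subspace_centralizer]) (use no assms H_abelian in \<open>auto simp: root_space_def\<close>)
    then show False using assms center_eq_0 by blast
  qed
  then show ?thesis using that by blast
qed

section \<open>Nondegeneracy of the Killing form\<close>

text \<open>The roots take integer values on an element \<open>h\<close> on which all simple roots are 1, so that
  \<open>killing h h\<close> is a sum of squares of integers that are not all 0.\<close>

lemma killing_nonzero: "\<exists>h. killing h h \<noteq> 0"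
proof -
  have \<Pi>: "finite \<Pi>" "\<Pi> \<subseteq> roots H"
    "\<And>c. (\<And>x. (\<Sum>\<beta>\<in>\<Pi>. c \<beta> * \<beta> x) = 0) \<Longrightarrow> \<forall>\<beta>\<in>\<Pi>. c \<beta> = 0"
    using base by (auto simp: root_base_def)
  have dual: "\<beta> \<in> dual H" if "\<beta> \<in> \<Pi>" for \<beta> using \<Pi>(2) rootsD that by blast
  have "\<exists>h\<in>H. \<forall>\<beta>\<in>\<Pi>. \<beta> h = (\<lambda>_. 1) \<beta>"
  proof (rule functionals_separated[OF subspace_H \<Pi>(1)])
    fix c assume c: "\<And>x. x \<in> H \<Longrightarrow> (\<Sum>\<beta>\<in>\<Pi>. c \<beta> * \<beta> x) = 0"
    \<comment> \<open>\<open>root_base\<close> states independence for relations on the whole space;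
      outside \<open>H\<close> all simple roots are 0, so a relation on \<open>H\<close>
      suffices.\<close>
    have "(\<Sum>\<beta>\<in>\<Pi>. c \<beta> * \<beta> x) = 0" for x
    proof (cases "x \<in> H")
      case False
      then show ?thesis using dual by (intro sum.neutral) (auto simp: dual_def)
    qed (use c in simp)
    then show "\<forall>\<beta>\<in>\<Pi>. c \<beta> = 0" by (rule \<Pi>(3))
  qed (use dual in \<open>auto simp: dual_def\<close>)
  then obtain h where h: "h \<in> H" "\<And>\<beta>. \<beta> \<in> \<Pi> \<Longrightarrow> \<beta> h = 1" by auto
  \<comment> \<open>The number \<open>n\<close> is the height of \<alpha>, the sum of its
    coefficients in the base.\<close>
  have cone: "\<exists>n::nat. \<alpha> h = of_nat n \<and> (n = 0 \<longrightarrow> \<alpha> = (\<lambda>_. 0))" if "\<alpha> \<in> nat_cone \<Pi>" for \<alpha>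
  proof -
    obtain n :: "('a \<Rightarrow> complex) \<Rightarrow> nat" where n: "\<alpha> = (\<lambda>x. \<Sum>\<beta>\<in>\<Pi>. of_nat (n \<beta>) * \<beta> x)"
      using \<open>\<alpha> \<in> nat_cone \<Pi>\<close> by (auto simp: nat_cone_def)
    have "of_nat (n \<beta>) * \<beta> h = of_nat (n \<beta>)" if "\<beta> \<in> \<Pi>" for \<beta>
      using h(2)[OF that] by simp
    from sum.cong[OF refl this] n have "\<alpha> h = of_nat (\<Sum>\<beta>\<in>\<Pi>. n \<beta>)" by simp
    moreover have "\<alpha> = (\<lambda>_. 0)" if "(\<Sum>\<beta>\<in>\<Pi>. n \<beta>) = 0" using that n \<Pi>(1) by simp
    ultimately show ?thesis by (intro exI[of _ "\<Sum>\<beta>\<in>\<Pi>. n \<beta>"] conjI impI)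
  qed
  have sq: "\<exists>n::nat. (\<alpha> h)\<^sup>2 = of_nat n \<and> (n = 0 \<longrightarrow> \<alpha> = (\<lambda>_. 0))" if "\<alpha> \<in> weights" for \<alpha>
  proof -
    have "(\<lambda>_. 0) \<in> nat_cone \<Pi>" unfolding nat_cone_def
      by (rule CollectI, rule exI[of _ "\<lambda>_. 0"]) simp
    then consider (p) "\<alpha> \<in> nat_cone \<Pi>" | (q) "(\<lambda>x. - \<alpha> x) \<in> nat_cone \<Pi>"
    proof -
      have "\<alpha> \<in> pos_roots \<or> \<alpha> \<in> neg_roots \<or> \<alpha> = (\<lambda>_. 0)"
        using \<open>\<alpha> \<in> weights\<close> roots_split by blast
      with \<open>(\<lambda>_. 0) \<in> nat_cone \<Pi>\<close> show ?thesis
        using that by (auto simp: pos_roots_def neg_roots_def)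
    qed
    then show ?thesis
    proof cases
      case p
      then obtain n :: nat where "\<alpha> h = of_nat n" "n = 0 \<longrightarrow> \<alpha> = (\<lambda>_. 0)" using cone by blast
      then show ?thesis by (intro exI[of _ "n\<^sup>2"]) simp
    next
      case q
      then obtain n :: nat where "- \<alpha> h = of_nat n" "n = 0 \<longrightarrow> (\<lambda>x. - \<alpha> x) = (\<lambda>_. 0)"
        using cone by blast
      moreover have "(\<alpha> h)\<^sup>2 = (- \<alpha> h)\<^sup>2" by simp
      ultimately show ?thesis by (intro exI[of _ "n\<^sup>2"]) (simp add: fun_eq_iff)
    qed
  qed
  obtain B wt where B: "finite B" "independent B" "span B = UNIV"
    and wt: "\<And>b. b \<in> B \<Longrightarrow> wt b \<in> weights" "\<And>b. b \<in> B \<Longrightarrow> b \<in> g (wt b)"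
    by (rule weight_basis) blast
  obtain n :: "'a \<Rightarrow> nat" where
    n: "\<And>b. b \<in> B \<Longrightarrow> (wt b h)\<^sup>2 = of_nat (n b)" "\<And>b. b \<in> B \<Longrightarrow> n b = 0 \<Longrightarrow> wt b = (\<lambda>_. 0)"
    using sq[OF wt(1)] by metis
  have lin: "Vector_Spaces.linear scale scale (\<lambda>z. lie h (lie h z))"
    using Vector_Spaces.linear_compose[OF linear_lie_right linear_lie_right, of h h]
    by (simp add: comp_def)
  have "killing h h = (\<Sum>b\<in>B. representation B (lie h (lie h b)) b)"
    unfolding killing_def by (rule trace_eq_sum_basis[OF B lin])
  also have "\<dots> = (\<Sum>b\<in>B. of_nat (n b))"
  proof (rule sum.cong[OF refl])
    fix b assume b: "b \<in> B"
    then have "lie h (lie h b) = (wt b h)\<^sup>2 *s b"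
      using wt(2)[OF b] h by (simp add: root_space_def power2_eq_square)
    then show "representation B (lie h (lie h b)) b = of_nat (n b)"
      using B b n by (simp add: representation_scale representation_basis)
  qed
  finally have k: "killing h h = of_nat (\<Sum>b\<in>B. n b)" by simp
  \<comment> \<open>If all the squares were 0, every basis vector would have weight 0 and the whole
    algebra would be the abelian \<open>H\<close>.\<close>
  have "(\<Sum>b\<in>B. n b) \<noteq> 0"
  proof
    assume "(\<Sum>b\<in>B. n b) = 0"
    then have "B \<subseteq> H" using n(2) B(1) wt(2) root_space_0 by fastforce
    then have "H = UNIV" using span_minimal[OF _ subspace_H] B by blast
    then show False using H_abelian nonabelian by blast
  qed
  then have "killing h h \<noteq> 0" unfolding k of_nat_eq_0_iff .
  then show ?thesis ..
qed

text \<open>The radical of the form is an ideal by invariance, and it is proper because the form is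
  not zero.\<close>

lemma killing_nondegenerate:
  assumes "\<And>y. killing x y = 0"
  shows "x = 0"
proof (rule ccontr)
  assume "x \<noteq> 0"
  moreover have "subspace {x. \<forall>y. killing x y = 0}" by (auto simp: subspace_def)
  moreover have "killing (lie z w) y = 0" if "\<forall>y. killing w y = 0" for z w y
    using that by (subst lie_skew) (simp add: killing_invariant)
  ultimately have "{x. \<forall>y. killing x y = 0} = UNIV"
    using assms by (intro ideal_UNIV_eq[of _ x]) auto
  then show False using killing_nonzero by blast
qed

text \<open>A nonzero \<open>x\<close> is not orthogonal to everything, but it is orthogonal to all
  weight spaces other than the opposite one. The case \<alpha> = 0 is included and gives
  nondegeneracy on \<open>H\<close>.\<close>

lemma killing_pairing:
  assumes "x \<in> g \<alpha>" "x \<noteq> 0"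
  obtains y where "y \<in> g (\<lambda>h. - \<alpha> h)" "killing x y \<noteq> 0"
proof -
  have "\<exists>y\<in>g (\<lambda>h. - \<alpha> h). killing x y \<noteq> 0"
  proof (rule ccontr)
    assume no: "\<not> ?thesis"
    have "y \<in> {y. killing x y = 0}" for y
    proof (rule UNIV_weight_induct[OF subspace_killing_orthogonal])
      fix \<beta> assume "\<beta> \<in> weights"
      show "g \<beta> \<subseteq> {y. killing x y = 0}"
      proof (cases "\<forall>h\<in>H. \<alpha> h + \<beta> h = 0")
        case True
        then have "g \<beta> = g (\<lambda>h. - \<alpha> h)"
          by (intro root_space_cong) (simp add: eq_neg_iff_add_eq_0 add.commute)
        then show ?thesis using no by blast
      next
        case False
        then show ?thesis using killing_root_space_eq_0[OF assms(1)] by blast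
      qed
    qed
    then show False using killing_nondegenerate assms by blast
  qed
  then show ?thesis using that by blast
qed

lemma uminus_root:
  assumes "\<alpha> \<in> roots H"
  shows "(\<lambda>h. - \<alpha> h) \<in> roots H"
proof -
  obtain x where x: "x \<in> g \<alpha>" "x \<noteq> 0" using assms rootsD by blast
  then obtain y where "y \<in> g (\<lambda>h. - \<alpha> h)" "killing x y \<noteq> 0" by (rule killing_pairing)
  moreover from this have "y \<noteq> 0" by auto
  moreover have "(\<lambda>h. - \<alpha> h) \<noteq> (\<lambda>_. 0)" using assms by (auto simp: roots_def fun_eq_iff)
  ultimately show ?thesis using rootsI dual_uminus rootsD(1)[OF assms] by blast
qed

lemma uminus_neg_root: "\<alpha> \<in> neg_roots \<Longrightarrow> (\<lambda>h. - \<alpha> h) \<in> pos_roots"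
  using uminus_root by (simp add: pos_roots_def neg_roots_def)

lemma lie_opposite_in_H:
  assumes "x \<in> g \<alpha>" "y \<in> g (\<lambda>h. - \<alpha> h)"
  shows "lie x y \<in> H"
  using lie_root_space[OF assms] root_space_0 by simp

lemma lie_opposite_nonzero:
  assumes "\<alpha> \<in> roots H" "x \<in> g \<alpha>" "killing x y \<noteq> 0"
  shows "lie x y \<noteq> 0"
proof
  obtain h where "h \<in> H" "\<alpha> h \<noteq> 0" using rootsD assms by blast
  moreover assume "lie x y = 0"
  ultimately show False using killing_lie_root_space[OF assms(2), of h y] assms(3) by simp
qed

section \<open>Root strings\<close>

lemma lie_funpow_root_space:
  assumes "x \<in> g \<alpha>" "v \<in> g \<beta>"
  shows "(lie x ^^ k) v \<in> g (\<lambda>h. \<beta> h + of_nat k * \<alpha> h)"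
proof (induction k)
  case (Suc k)
  then have "lie x ((lie x ^^ k) v) \<in> g (\<lambda>h. \<alpha> h + (\<beta> h + of_nat k * \<alpha> h))"
    by (intro lie_root_space assms)
  then show ?case by (simp add: algebra_simps)
qed (use assms in simp)

text \<open>Otherwise the string through \<beta> would consist of infinitely many distinct
  weights.\<close>

lemma lie_funpow_eventually_0:
  assumes "\<alpha> \<in> roots H" "\<beta> \<in> dual H" "x \<in> g \<alpha>" "v \<in> g \<beta>"
  shows "\<exists>k. (lie x ^^ k) v = 0"
proof (rule ccontr)
  assume no: "\<not> ?thesis"
  define \<gamma> where "\<gamma> k = (\<lambda>h. \<beta> h + of_nat k * \<alpha> h)" for k :: nat
  have "\<gamma> k \<in> weights" for k
  proof (rule rootsI)
    show "\<gamma> k \<in> dual H"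
      using dual_lin_comb[OF assms(2) rootsD(1)[OF assms(1)], of 1] by (simp add: \<gamma>_def)
    show "(lie x ^^ k) v \<in> g (\<gamma> k)"
      unfolding \<gamma>_def by (rule lie_funpow_root_space[OF assms(3,4)])
  qed (use no in blast)
  moreover have "inj \<gamma>"
  proof (rule injI)
    fix j k assume eq: "\<gamma> j = \<gamma> k"
    obtain h where "\<alpha> h \<noteq> 0" using rootsD assms by blast
    then show "j = k" using fun_cong[OF eq, of h] by (simp add: \<gamma>_def)
  qed
  ultimately have "finite (UNIV :: nat set)"
    using finite_roots by (metis finite_insert inj_on_finite image_subsetI)
  then show False by simp
qed

text \<open>The sl2 string formula: the coefficient is minus the sum of the eigenvalues
  \<open>c + j * a\<close> for \<open>j\<close> from 0 to \<open>k\<close>. The elements are not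
  normalized to an sl2 triple, since the case \<open>a = 0\<close> is also needed.\<close>

lemma lie_lowering_funpow:
  assumes "lie (lie x y) x = a *s x" "lie y v = 0" "lie (lie x y) v = c *s v"
  shows "lie y ((lie x ^^ Suc k) v) =
    (- ((of_nat k + 1) * c + a * (of_nat k * (of_nat k + 1) / 2))) *s (lie x ^^ k) v"
proof -
  have wt: "lie (lie x y) ((lie x ^^ k) v) = (c + of_nat k * a) *s (lie x ^^ k) v" for k
  proof (induction k)
    case (Suc k)
    let ?h = "lie x y" and ?u = "(lie x ^^ k) v"
    have "lie ?h (lie x ?u) = lie (lie ?h x) ?u + lie x (lie ?h ?u)"
      using lie_lie[of ?h x ?u] by (simp del: lie_lie)
    then show ?case using Suc assms by (simp add: scale_left_distrib algebra_simps)
  qed (use assms in simp)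
  have swap: "lie y (lie x u) = lie x (lie y u) - lie (lie x y) u" for u
    using lie_lie[of x y u] by simp
  show ?thesis
  proof (induction k)
    case 0
    then show ?case using swap[of v] assms by simp
  next
    case (Suc k)
    let ?u = "(lie x ^^ Suc k) v" and ?s = "(of_nat k + 1) * c + a * (of_nat k * (of_nat k + 1) / 2)"
    have "lie y (lie x ?u) = lie x (lie y ?u) - lie (lie x y) ?u"
      by (rule swap)
    also have "\<dots> = (- ?s) *s ?u - (c + of_nat (Suc k) * a) *s ?u"
      unfolding Suc wt by simp
    also have "\<dots> = (- ?s - (c + of_nat (Suc k) * a)) *s ?u"
      by (rule scale_left_diff_distrib[symmetric])
    also have "- ?s - (c + of_nat (Suc k) * a) =
      - ((of_nat (Suc k) + 1) * c + a * (of_nat (Suc k) * (of_nat (Suc k) + 1) / 2))"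
      by (simp add: field_simps)
    finally show ?case by simp
  qed
qed

text \<open>By \<open>nz\<close> no coefficient in the lowering formula vanishes, so the string
  raised from a nonzero \<open>v\<close> would never end, against finiteness of the weights.\<close>

lemma lowest_weight_vector_eq_0:
  assumes "\<alpha> \<in> roots H" "\<beta> \<in> dual H" "x \<in> g \<alpha>" "y \<in> g (\<lambda>h. - \<alpha> h)" "v \<in> g \<beta>" "lie y v = 0"
    and nz: "\<And>k. (of_nat k + 1) * \<beta> (lie x y) + \<alpha> (lie x y) * (of_nat k * (of_nat k + 1) / 2) \<noteq> 0"
  shows "v = 0"
proof (rule ccontr)
  assume "v \<noteq> 0"
  have h: "lie x y \<in> H" using assms lie_opposite_in_H by blast
  have "(lie x ^^ k) v \<noteq> 0" for k
  proof (induction k)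
    case (Suc k)
    have "lie (lie x y) x = \<alpha> (lie x y) *s x" "lie (lie x y) v = \<beta> (lie x y) *s v"
      using assms h by (auto simp: root_space_def)
    from lie_lowering_funpow[OF this(1) assms(6) this(2), of k]
    have "lie y ((lie x ^^ Suc k) v) \<noteq> 0"
      using Suc nz[of k] by (simp only: scale_eq_0_iff neg_equal_0_iff_equal) simp
    then show ?case by auto
  qed (use \<open>v \<noteq> 0\<close> in simp)
  then show False using lie_funpow_eventually_0[OF assms(1-3,5)] by blast
qed

text \<open>\<open>lie x y\<close> is nonzero, so some root \<beta> does not vanish on it. If
  \<alpha> did, every lowering coefficient along a \<beta>-string would be a nonzero multiple of
  \<open>\<beta> (lie x y)\<close>, and the string would be infinite.\<close>

lemma root_of_coroot_nonzero:
  assumes \<alpha>: "\<alpha> \<in> roots H" and x: "x \<in> g \<alpha>" and y: "y \<in> g (\<lambda>h. - \<alpha> h)" and xy: "killing x y \<noteq> 0"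
  shows "\<alpha> (lie x y) \<noteq> 0"
proof
  assume 0: "\<alpha> (lie x y) = 0"
  have "lie x y \<in> H" "lie x y \<noteq> 0"
    using lie_opposite_in_H[OF x y] lie_opposite_nonzero[OF \<alpha> x xy] by auto
  then obtain \<beta> where \<beta>: "\<beta> \<in> roots H" "\<beta> (lie x y) \<noteq> 0" by (rule root_nonvanishing)
  obtain v where v: "v \<in> g \<beta>" "v \<noteq> 0" using rootsD \<beta> by blast
  \<comment> \<open>The first power of \<open>lie y\<close> that kills \<open>v\<close>; the power
    before it gives a nonzero vector annihilated by \<open>y\<close>.\<close>
  define n where "n = (LEAST k. (lie y ^^ k) v = 0)"
  have ex: "\<exists>k. (lie y ^^ k) v = 0"
    using lie_funpow_eventually_0 uminus_root[OF \<alpha>] rootsD(1)[OF \<beta>(1)] y v(1) by blast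
  have n: "(lie y ^^ n) v = 0" unfolding n_def using ex by (rule LeastI_ex)
  then obtain m where m: "n = Suc m" using v by (cases n) auto
  have "(lie y ^^ m) v \<noteq> 0" using not_less_Least[of m "\<lambda>k. (lie y ^^ k) v = 0"] m n_def by auto
  moreover have "(lie y ^^ m) v = 0"
  proof (rule lowest_weight_vector_eq_0[OF \<alpha> _ x y])
    show "(lie y ^^ m) v \<in> g (\<lambda>h. \<beta> h + of_nat m * - \<alpha> h)"
      using lie_funpow_root_space[OF y v(1)] by simp
    show "(\<lambda>h. \<beta> h + of_nat m * - \<alpha> h) \<in> dual H"
      using dual_lin_comb[OF rootsD(1)[OF \<beta>(1)] rootsD(1)[OF \<alpha>], of 1 "- of_nat m"] by simp
    show "lie y ((lie y ^^ m) v) = 0" using n m by simp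
    have "of_nat k + 1 \<noteq> (0 :: complex)" for k
      using of_nat_eq_0_iff[of "Suc k", where 'a = complex] by (simp add: add.commute del: of_nat_eq_0_iff)
    then show "(of_nat k + 1) * (\<beta> (lie x y) + of_nat m * - \<alpha> (lie x y)) +
      \<alpha> (lie x y) * (of_nat k * (of_nat k + 1) / 2) \<noteq> 0" for k
      using 0 \<beta> by simp
  qed
  ultimately show False by blast
qed

text \<open>Subtracting a multiple of \<open>x\<close> from \<open>z\<close> leaves \<open>w\<close>
  orthogonal to \<open>y\<close>. Then \<open>w\<close> commutes with \<open>y\<close> and would
  start a string at \<alpha> itself, whose lowering coefficients are nonzero multiples of
  \<open>\<alpha> (lie x y)\<close>; so \<open>w = 0\<close>.\<close>

lemma root_space_one_dimensional:
  assumes \<alpha>: "\<alpha> \<in> roots H" and x: "x \<in> g \<alpha>" "x \<noteq> 0" and z: "z \<in> g \<alpha>"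
  shows "\<exists>c. z = c *s x"
proof -
  obtain y where y: "y \<in> g (\<lambda>h. - \<alpha> h)" "killing x y \<noteq> 0" using killing_pairing[OF x] by blast
  define c where "c = killing z y / killing x y"
  define w where "w = z + (- c) *s x"
  have w: "w \<in> g \<alpha>" unfolding w_def by (intro subspace_add subspace_scale subspace_root_space x z)
  have wy: "killing w y = 0" unfolding w_def c_def killing_bilinear using y by simp
  \<comment> \<open>\<open>lie w y\<close> lies in \<open>H\<close> and is orthogonal to
    \<open>H\<close>, where the Killing form is nondegenerate.\<close>
  have "lie w y = 0"
  proof (rule ccontr)
    assume "lie w y \<noteq> 0"
    moreover have "lie w y \<in> g (\<lambda>_. 0)" using lie_root_space[OF w y(1)] by simp
    ultimately obtain k where "k \<in> g (\<lambda>_. - 0)" "killing (lie w y) k \<noteq> 0"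
      using killing_pairing by blast
    then show False
      using killing_lie_root_space[OF w, of k y] wy root_space_0 killing_commute by simp
  qed
  then have "lie y w = 0" by (subst lie_skew) simp
  have nz: "\<alpha> (lie x y) \<noteq> 0" by (rule root_of_coroot_nonzero[OF \<alpha> x(1) y])
  have "(of_nat k + 1) * \<alpha> (lie x y) + \<alpha> (lie x y) * (of_nat k * (of_nat k + 1) / 2) \<noteq> 0" for k
  proof -
    have "(of_nat k + 1) * \<alpha> (lie x y) + \<alpha> (lie x y) * (of_nat k * (of_nat k + 1) / 2)
      = of_nat ((k + 1) * (k + 2)) * \<alpha> (lie x y) / 2"
      by (simp add: field_simps)
    then show ?thesis using nz by (simp only: divide_eq_0_iff
          mult_eq_0_iff of_nat_eq_0_iff) simp
  qed
  then have "w = 0"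
    using lowest_weight_vector_eq_0[OF \<alpha> rootsD(1)[OF \<alpha>] x(1) y(1) w \<open>lie y w = 0\<close>] by blast
  then have "z = c *s x" by (simp add: w_def)
  then show ?thesis ..
qed

section \<open>Ideals of the finite-dimensional Borel subalgebra\<close>

lemma H_subset_borel: "H \<subseteq> borel H Np" and Np_subset_borel: "Np \<subseteq> borel H Np"
  using subspace_0[OF subspace_H] subspace_0[OF subspace_Np]
  by (force simp: borel_def)+

lemma borel_lie_Np:
  assumes "b \<in> borel H Np" "x \<in> Np"
  shows "lie b x \<in> Np"
proof -
  have sub: "subspace {x. lie z x \<in> Np}" "subspace {z. lie z x \<in> Np}" for z x
    using subspace_Np by (auto simp: subspace_def)
  have H: "lie h x \<in> Np" if "h \<in> H" for h
  proof -
    have "Np \<subseteq> {x. lie h x \<in> Np}"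
      by (subst Np_eq, rule span_minimal[OF _ sub(1)])
        (use that root_space_pos subspace_Np in \<open>fastforce simp: root_space_def pos_roots_def
          intro: subspace_scale\<close>)
    then show ?thesis using assms by blast
  qed
  have root: "lie e y \<in> Np" if "\<alpha> \<in> pos_roots" "e \<in> g \<alpha>" "y \<in> Np" for \<alpha> e y
  proof -
    have "Np \<subseteq> {y. lie e y \<in> Np}"
      by (subst Np_eq, rule span_minimal[OF _ sub(1)])
        (use that pos_roots_add in \<open>auto simp: pos_roots_def\<close>)
    then show ?thesis using that by blast
  qed
  have "Np \<subseteq> {z. lie z x \<in> Np}"
    by (subst Np_eq, rule span_minimal[OF _ sub(2)])
      (use assms root in \<open>auto simp: pos_roots_def\<close>)
  then have "lie z x \<in> Np" if "z \<in> Np" for z using that by blast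
  then show ?thesis
    using assms H subspace_add[OF subspace_Np] by (auto simp: borel_def)
qed

text \<open>The ideal is \<open>H\<close>-stable, so it contains the weight components of its
  elements. Weight 0 cannot occur inside \<open>Np\<close>, and a nonzero component brings in its
  whole one-dimensional root space.\<close>

lemma borel_ideal_eq_span:
  assumes "I \<in> borel_ideals H Np"
  shows "I = span (\<Union>\<alpha>\<in>{\<alpha>\<in>roots H. g \<alpha> \<subseteq> I}. g \<alpha>)" (is "I = span ?U")
proof
  have I: "subspace I" "I \<subseteq> Np" "\<And>b x. b \<in> borel H Np \<Longrightarrow> x \<in> I \<Longrightarrow> lie b x \<in> I"
    using assms by (auto simp: borel_ideals_def ideal_of_def)
  then show "span ?U \<subseteq> I" by (intro span_minimal) auto
  show "I \<subseteq> span ?U"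
  proof
    fix x assume "x \<in> I"
    then obtain f where f: "\<And>\<alpha>. \<alpha> \<in> weights \<Longrightarrow> f \<alpha> \<in> g \<alpha> \<inter> I" "x = (\<Sum>\<alpha>\<in>weights. f \<alpha>)"
      using H_invariant_components[OF I(1)] I(3) H_subset_borel by (metis subsetD)
    have "f \<alpha> \<in> span ?U" if \<alpha>: "\<alpha> \<in> weights" for \<alpha>
    proof (cases "f \<alpha> = 0")
      case False
      have "\<alpha> \<noteq> (\<lambda>_. 0)"
      proof
        assume "\<alpha> = (\<lambda>_. 0)"
        then show False using f(1)[OF \<alpha>] I(2) root_space_0 Np_H_disjoint False by blast
      qed
      then have root: "\<alpha> \<in> roots H" using \<alpha> by blast
      have "g \<alpha> \<subseteq> I"
      proof
        fix z assume "z \<in> g \<alpha>"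
        then obtain c where "z = c *s f \<alpha>"
          using root_space_one_dimensional[OF root] f(1)[OF \<alpha>] False by blast
        then show "z \<in> I" using f(1)[OF \<alpha>] I(1) subspace_scale by blast
      qed
      then show ?thesis using root f(1)[OF \<alpha>] by (intro span_base) blast
    qed (simp add: span_zero)
    then show "x \<in> span ?U" unfolding f(2) by (rule span_sum)
  qed
qed

text \<open>Finiteness gives the bound its content, since \<open>card\<close> of an infinite set is
  0.\<close>

lemma finite_borel_ideals: "finite (borel_ideals H Np)"
proof -
  have "borel_ideals H Np \<subseteq> (\<lambda>A. span (\<Union>\<alpha>\<in>A. g \<alpha>)) ` Pow (roots H)"
    using borel_ideal_eq_span by blast
  then show ?thesis using finite_roots finite_surj by (metis finite_Pow_iff)
qed

section \<open>Splitting a root\<close>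

text \<open>The root vectors on which \<open>h\<close> acts nontrivially and their pairwise brackets span an ideal, hence
  all of \<open>\<g>\<close>; a root vector killed by \<open>h\<close> must therefore come from such a bracket.\<close>

lemma root_splitting:
  assumes h: "h \<in> H" "h \<noteq> 0" and \<alpha>: "\<alpha> \<in> roots H" "\<alpha> h = 0"
  obtains \<gamma> \<delta> x y where "\<gamma> \<in> roots H" "\<delta> \<in> roots H" "\<gamma> h \<noteq> 0" "\<delta> h \<noteq> 0"
    "\<alpha> = (\<lambda>k. \<gamma> k + \<delta> k)" "x \<in> g \<gamma>" "y \<in> g \<delta>" "lie x y \<noteq> 0"
proof -
  \<comment> \<open>Ranging over all of \<open>dual H\<close>, not just the roots, puts zero
    brackets into \<open>G\<close> without a separate case.\<close>
  define G where "G = (\<Union>\<gamma>\<in>{\<gamma>\<in>dual H. \<gamma> h \<noteq> 0}. g \<gamma>)"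
  define K where "K = {lie x y | x y. x \<in> G \<and> y \<in> G}"
  define S where "S = span (G \<union> K)"
  have GS: "G \<subseteq> S" and KS: "K \<subseteq> S" unfolding S_def by (auto intro: span_base)
  have GI: "x \<in> G" if "x \<in> g \<gamma>" "\<gamma> \<in> dual H" "\<gamma> h \<noteq> 0" for x \<gamma> using that by (auto simp: G_def)
  have "subspace S" by (simp add: S_def)
  have ideal: "lie z w \<in> S" if "w \<in> S" for z w
  proof -
    have "z \<in> {z. \<forall>w\<in>S. lie z w \<in> S}"
    proof (rule UNIV_weight_induct)
      show "subspace {z. \<forall>w\<in>S. lie z w \<in> S}"
        using \<open>subspace S\<close> by (auto simp: subspace_def)
      fix \<delta> assume \<delta>: "\<delta> \<in> weights"
      note \<delta>' = weights_dual[OF \<delta>]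
      have "S \<subseteq> {w. lie z w \<in> S}" if z: "z \<in> g \<delta>" for z
        unfolding S_def
      proof (rule span_minimal)
        show "subspace {w. lie z w \<in> span (G \<union> K)}" by (auto simp: subspace_def span_add span_scale span_zero)
        have GG: "lie z w \<in> G" if "\<delta> h = 0" "w \<in> G" for w
        proof -
          obtain \<gamma> where \<gamma>: "\<gamma> \<in> dual H" "\<gamma> h \<noteq> 0" "w \<in> g \<gamma>" using \<open>w \<in> G\<close> by (auto simp: G_def)
          then show ?thesis
            using GI[OF lie_root_space[OF z \<gamma>(3)] dual_add[OF \<delta>' \<gamma>(1)]] \<open>\<delta> h = 0\<close> by simp
        qed
        have zG: "z \<in> G" if "\<delta> h \<noteq> 0" using GI z \<delta>' that by blast
        have wG: "lie z w \<in> S" if "w \<in> G" for w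
          using GG zG GS KS that by (cases "\<delta> h = 0") (auto simp: K_def)
        have wK: "lie z w \<in> S" if "w \<in> K" for w
        proof -
          obtain x y where w: "w = lie x y" "x \<in> G" "y \<in> G"
            using \<open>w \<in> K\<close> by (auto simp: K_def)
          obtain \<gamma> \<gamma>' where \<gamma>: "\<gamma> \<in> dual H" "\<gamma> h \<noteq> 0" "x \<in> g \<gamma>" "\<gamma>' \<in> dual H" "\<gamma>' h \<noteq> 0" "y \<in> g \<gamma>'"
            using w by (auto simp: G_def)
          note wt = lie_root_space[OF \<gamma>(3,6)]
          note dual = dual_add[OF \<gamma>(1,4)]
          show ?thesis
          \<comment> \<open>If \<open>\<delta> h = 0\<close>, then \<open>lie z\<close> preserves
            \<open>G\<close>, and the Jacobi identity handles \<open>K\<close>. Otherwise either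
            \<open>w\<close> has weight 0 at \<open>h\<close> and \<open>lie z w\<close> is in
            \<open>G\<close>, or \<open>w\<close> itself is in \<open>G\<close>.\<close>
          proof (cases "\<delta> h = 0")
            case True
            have "lie z w = lie (lie z x) y + lie x (lie z y)" by (simp add: w lie_lie)
            moreover have "lie (lie z x) y \<in> K" "lie x (lie z y) \<in> K"
              using GG[OF True] w by (auto simp: K_def)
            ultimately show ?thesis using KS \<open>subspace S\<close> by (auto intro: subspace_add)
          next
            case False
            show ?thesis
            proof (cases "\<gamma> h + \<gamma>' h = 0")
              case True
              then show ?thesis
                using GI[OF lie_root_space[OF z wt] dual_add[OF \<delta>' dual]] False GS w by auto
            next
              case no: False
              then have "w \<in> G" using GI[OF wt dual] w by simp
              then show ?thesis by (rule wG)
            qed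
          qed
        qed
        show "G \<union> K \<subseteq> {w. lie z w \<in> span (G \<union> K)}" using wG wK unfolding S_def by blast
      qed
      then show "g \<delta> \<subseteq> {z. \<forall>w\<in>S. lie z w \<in> S}" by blast
    qed
    then show ?thesis using that by blast
  qed
  obtain \<beta> where \<beta>: "\<beta> \<in> roots H" "\<beta> h \<noteq> 0" using root_nonvanishing[OF h] by blast
  obtain b where b: "b \<in> g \<beta>" "b \<noteq> 0" using rootsD \<beta> by blast
  have "b \<in> S" using GS GI[OF b(1) rootsD(1)[OF \<beta>(1)] \<beta>(2)] by blast
  then have S: "S = UNIV" using ideal_UNIV_eq[OF \<open>subspace S\<close> ideal _ b(2)] by blast
  obtain e where e: "e \<in> g \<alpha>" "e \<noteq> 0" using rootsD \<alpha> by blast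
  obtain z where z: "z \<in> g (\<lambda>h. - \<alpha> h)" "killing e z \<noteq> 0" using killing_pairing[OF e] by blast
  \<comment> \<open>\<open>z\<close> pairs nontrivially with \<open>e\<close>, hence with a
    generator of \<open>S\<close>. Orthogonality of weights excludes \<open>G\<close>, as
    \<open>z\<close> has weight 0 at \<open>h\<close>, so the generator is a bracket in
    \<open>K\<close>.\<close>
  have "\<exists>w\<in>G \<union> K. killing z w \<noteq> 0"
  proof (rule ccontr)
    assume "\<not> ?thesis"
    then have "S \<subseteq> {w. killing z w = 0}"
      unfolding S_def by (intro span_minimal subspace_killing_orthogonal) blast
    then show False using S z killing_commute by auto
  qed
  moreover have "killing z w = 0" if "w \<in> G" for w
    using that killing_root_space_eq_0[OF z(1) _ h(1)] \<alpha> by (auto simp: G_def)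
  ultimately obtain x y where xy: "x \<in> G" "y \<in> G" "killing z (lie x y) \<noteq> 0" by (auto simp: K_def)
  obtain \<gamma> \<delta> where \<gamma>: "\<gamma> \<in> dual H" "\<gamma> h \<noteq> 0" "x \<in> g \<gamma>" "\<delta> \<in> dual H" "\<delta> h \<noteq> 0" "y \<in> g \<delta>"
    using xy by (auto simp: G_def)
  have "x \<noteq> 0" "y \<noteq> 0" "lie x y \<noteq> 0" using xy by auto
  then have roots: "\<gamma> \<in> roots H" "\<delta> \<in> roots H"
    using rootsI[OF \<gamma>(1,3)] rootsI[OF \<gamma>(4,6)] \<gamma> by auto
  have "\<alpha> k = \<gamma> k + \<delta> k" if "k \<in> H" for k
    using killing_root_space_eq_0[OF z(1) lie_root_space[OF \<gamma>(3,6)] that] xy by force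
  then have "\<alpha> = (\<lambda>k. \<gamma> k + \<delta> k)"
    by (intro dual_eqI[of _ H] dual_add \<gamma> rootsD \<alpha>)
  then show ?thesis using that roots \<gamma> \<open>lie x y \<noteq> 0\<close> by blast
qed

lemma pos_root_of_sum:
  assumes "\<alpha> \<in> pos_roots" "\<gamma> \<in> roots H" "\<delta> \<in> roots H" "\<alpha> = (\<lambda>k. \<gamma> k + \<delta> k)"
  shows "\<gamma> \<in> pos_roots \<or> \<delta> \<in> pos_roots"
proof (rule ccontr)
  assume "\<not> ?thesis"
  then have "\<gamma> \<in> neg_roots" "\<delta> \<in> neg_roots" using assms roots_split by auto
  then have "(\<lambda>k. - \<gamma> k + - \<delta> k) \<in> nat_cone \<Pi>" by (intro nat_cone_add) (simp_all add: neg_roots_def)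
  then have "\<alpha> \<in> neg_roots" using assms by (simp add: neg_roots_def pos_roots_def)
  then show False using assms pos_neg_disjoint by blast
qed

section \<open>Layers of an ideal of the affine Borel subalgebra\<close>

definition layer :: "'a affine set \<Rightarrow> int \<Rightarrow> 'a set" where
  "layer I k = {y. (single k y, 0, 0) \<in> I}"

text \<open>The support in coordinates: \<open>(\<alpha>, k)\<close> stands for \<alpha> + k
  \<delta>, and \<alpha> = 0 gives the imaginary roots.\<close>

definition occurring :: "'a affine set \<Rightarrow> (('a \<Rightarrow> complex) \<times> int) set" where
  "occurring I = {(\<alpha>, k). \<alpha> \<in> dual H \<and> (\<exists>y\<in>g \<alpha>. y \<in> layer I k \<and> y \<noteq> 0)}"

text \<open>\<open>aff_weight \<alpha> k\<close> is \<open>\<alpha> + k \<delta>\<close>.\<close>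

definition aff_weight :: "('a \<Rightarrow> complex) \<Rightarrow> int \<Rightarrow> 'a affine \<Rightarrow> complex" where
  "aff_weight \<alpha> k = (\<lambda>(f, a, b). if (f, a, b) \<in> aff_cartan H then \<alpha> (lookup f 0) + of_int k * b else 0)"

lemma aff_cartan_iff: "(f, a, b) \<in> aff_cartan H \<longleftrightarrow> (\<exists>h\<in>H. f = single 0 h)"
  by (auto simp: aff_cartan_def)

lemma aff_pos_single: "0 < k \<or> k = 0 \<and> x \<in> Np \<Longrightarrow> (single k x, 0, 0) \<in> aff_pos Np"
  unfolding aff_pos_def by (rule aff.span_base) auto

lemma aff_pos_form:
  assumes "z \<in> aff_pos Np"
  obtains f where "z = (f, 0, 0)" "\<And>k. k < 0 \<Longrightarrow> lookup f k = 0" "lookup f 0 \<in> Np"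
proof -
  let ?S = "{(f :: int \<Rightarrow>\<^sub>0 'a, a, b) | f a b. a = (0 :: complex) \<and> b = (0 :: complex) \<and>
    (\<forall>k<0. lookup f k = 0) \<and> lookup f 0 \<in> Np}"
  have "aff_pos Np \<subseteq> ?S"
    unfolding aff_pos_def
  proof (rule aff.span_minimal)
    show "aff.subspace ?S"
      using subspace_0[OF subspace_Np] subspace_add[OF subspace_Np] subspace_scale[OF subspace_Np]
      by (auto simp: aff.subspace_def lookup_add zero_prod_def)
    show "{(single 0 x, 0, 0) |x. x \<in> Np} \<union> {(single k x, 0, 0) |k x. 0 < k} \<subseteq> ?S"
      using subspace_0[OF subspace_Np] by (auto simp: lookup_single when_def)
  qed
  then show ?thesis using assms that by blast
qed

lemma aff_lie_cartan_single:
  "aff_lie (single 0 h, a, b) (single k y, 0, 0) = (single k (lie h y + (of_int k * b) *s y), 0, 0)"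
  by (simp add: loop_lie_single loop_deriv_simps loop_scale_simps loop_cocycle_single single_add
      mult.commute)

lemma aff_scale_single: "aff_scale c (single k y, 0, 0) = (single k (c *s y), 0, 0)"
  by (simp add: loop_scale_simps)

lemma aff_weight_cartan:
  "h \<in> H \<Longrightarrow> aff_weight \<alpha> k (single 0 h, a, b) = \<alpha> h + of_int k * b"
  by (auto simp: aff_weight_def aff_cartan_iff)

lemma single_in_aff_root_space:
  assumes "y \<in> g \<alpha>"
  shows "(single k y, 0, 0) \<in> aff.root_space (aff_cartan H) (aff_weight \<alpha> k)"
proof -
  have "aff_lie (single 0 h, a, b) (single k y, 0, 0)
      = aff_scale (aff_weight \<alpha> k (single 0 h, a, b)) (single k y, 0, 0)" if "h \<in> H" for h a b
  proof -
    have "lie h y = \<alpha> h *s y" using that assms by (simp add: root_space_def)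
    then show ?thesis
      by (simp only: aff_lie_cartan_single aff_scale_single aff_weight_cartan[OF that] scale_left_distrib)
  qed
  then show ?thesis by (auto simp: aff.root_space_def aff_cartan_def)
qed

text \<open>The eigenvalue of \<open>d\<close> confines the root vector to one degree
  \<open>k\<close>, and restricting \<beta> to \<open>H\<close> gives \<alpha>. Comparing
  eigenvalues on the nonzero \<open>z\<close> then determines \<beta> on all of the affine Cartan
  subalgebra.\<close>

lemma aff_root_space_single:
  assumes \<beta>: "\<beta> \<in> aff.dual (aff_cartan H)"
    and z: "z \<in> aff.root_space (aff_cartan H) \<beta>" "z \<in> aff_pos Np" "z \<noteq> 0"
  obtains \<alpha> k y where "\<alpha> \<in> dual H" "y \<in> g \<alpha>" "y \<noteq> 0" "z = (single k y, 0, 0)" "\<beta> = aff_weight \<alpha> k"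
proof -
  obtain f where f: "z = (f, 0, 0)" using aff_pos_form[OF z(2)] by blast
  with z(3) have "f \<noteq> 0" by (auto simp: zero_prod_def)
  then obtain k where k: "lookup f k \<noteq> 0" by (metis poly_mapping_eqI lookup_zero)
  define y where "y = lookup f k"
  have C: "(single 0 h, a, b) \<in> aff_cartan H" if "h \<in> H" for h a b
    using that by (auto simp: aff_cartan_def)
  have H0: "0 \<in> H" by (rule subspace_0[OF subspace_H])
  have wt: "aff_lie c z = aff_scale (\<beta> c) z" if "c \<in> aff_cartan H" for c
    using z(1) that by (simp add: aff.root_space_def)
  \<comment> \<open>The triple \<open>(single 0 0, 0, 1)\<close> is \<open>d\<close>, which acts on
    degree \<open>j\<close> by the scalar \<open>j\<close>.\<close>
  have "of_int j *s lookup f j = \<beta> (single 0 0, 0, 1) *s lookup f j" for j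
  proof -
    have "loop_deriv f = loop_scale (\<beta> (single 0 0, 0, 1)) f"
      using wt[OF C[OF H0, of 0 1]] by (simp add: f loop_scale_simps)
    then show ?thesis by (metis lookup_loop_deriv lookup_loop_scale)
  qed
  then have j: "lookup f j = 0 \<or> of_int j = \<beta> (single 0 0, 0, 1)" for j
    by (simp add: scale_cancel_right) blast
  have "lookup f j = 0" if "j \<noteq> k" for j
    using j[of j] j[of k] k that by (metis of_int_eq_iff)
  then have "f = single k y"
    by (intro poly_mapping_eqI) (auto simp: y_def lookup_single when_def)
  then have zy: "z = (single k y, 0, 0)" by (simp add: f)
  define \<alpha> where "\<alpha> h = (if h \<in> H then \<beta> (single 0 h, 0, 0) else 0)" for h
  have "\<alpha> \<in> dual H"
    unfolding dual_def mem_Collect_eq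
  proof (intro conjI allI ballI impI)
    fix x y c assume x: "x \<in> H"
    show "\<alpha> (c *s x) = c * \<alpha> x"
    proof -
      have "\<beta> (aff_scale c (single 0 x, 0, 0)) = c * \<beta> (single 0 x, 0, 0)"
        using \<beta> C[OF x] by (auto simp: aff.dual_def simp del: aff_scale.simps)
      then show ?thesis using x subspace_scale[OF subspace_H] by (simp add: \<alpha>_def aff_scale_single del: aff_scale.simps)
    qed
    assume y: "y \<in> H"
    have "\<beta> ((single 0 x, 0, 0) + (single 0 y, 0, 0)) = \<beta> (single 0 x, 0, 0) + \<beta> (single 0 y, 0, 0)"
      using \<beta> C[OF x] C[OF y] by (auto simp: aff.dual_def simp del: add_Pair)
    then show "\<alpha> (x + y) = \<alpha> x + \<alpha> y"
      using x y subspace_add[OF subspace_H] by (simp add: \<alpha>_def single_add)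
  qed (simp add: \<alpha>_def)
  moreover have y: "y \<in> g \<alpha>"
  proof -
    have "lie h y = \<alpha> h *s y" if "h \<in> H" for h
    proof -
      have "(single k (lie h y + (of_int k * 0) *s y), 0, 0) = (single k (\<beta> (single 0 h, 0, 0) *s y), 0 :: complex, 0 :: complex)"
        using wt[OF C[OF that, of 0 0]] unfolding zy aff_lie_cartan_single aff_scale_single .
      then have "lookup (single k (lie h y + (of_int k * 0) *s y)) k = lookup (single k (\<beta> (single 0 h, 0, 0) *s y)) k"
        by simp
      then show ?thesis using that by (simp add: \<alpha>_def)
    qed
    then show ?thesis by (simp add: root_space_def)
  qed
  moreover have "\<beta> = aff_weight \<alpha> k"
  proof
    fix c
    show "\<beta> c = aff_weight \<alpha> k c"
    proof (cases "c \<in> aff_cartan H")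
      case True
      then have "aff_scale (\<beta> c) z = aff_scale (aff_weight \<alpha> k c) z"
        using wt single_in_aff_root_space[OF y, of k] by (simp add: zy aff.root_space_def)
      then show ?thesis using z(3) by simp
    next
      case False
      then show ?thesis using \<beta> by (cases c) (auto simp: aff.dual_def aff_weight_def)
    qed
  qed
  ultimately show ?thesis using that k zy by (simp add: y_def)
qed

lemma aff_weight_in_dual:
  assumes "\<alpha> \<in> dual H"
  shows "aff_weight \<alpha> k \<in> aff.dual (aff_cartan H)"
proof -
  show ?thesis
    unfolding aff.dual_def mem_Collect_eq
  proof (intro conjI allI ballI impI)
    fix x y c assume "x \<in> aff_cartan H"
    then obtain h a b where x: "x = (single 0 h, a, b)" "h \<in> H" by (auto simp: aff_cartan_def)
    show "aff_weight \<alpha> k (aff_scale c x) = c * aff_weight \<alpha> k x"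
      using x assms subspace_scale[OF subspace_H, of h c]
      by (simp add: loop_scale_simps aff_weight_cartan dual_def algebra_simps)
    assume "y \<in> aff_cartan H"
    then obtain h' a' b' where y: "y = (single 0 h', a', b')" "h' \<in> H" by (auto simp: aff_cartan_def)
    show "aff_weight \<alpha> k (x + y) = aff_weight \<alpha> k x + aff_weight \<alpha> k y"
      using x y assms subspace_add[OF subspace_H, of h h']
      by (simp add: aff_weight_cartan dual_def algebra_simps flip: single_add)
  qed (auto simp: aff_weight_def)
qed

lemma aff_weight_eqD:
  assumes "aff_weight \<alpha> k = aff_weight \<beta> j" "\<alpha> \<in> dual H" "\<beta> \<in> dual H"
  shows "\<alpha> = \<beta>" "k = j"
proof -
  have eq: "\<alpha> h + of_int k * b = \<beta> h + of_int j * b" if "h \<in> H" for h b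
    using fun_cong[OF assms(1), of "(single 0 h, 0, b)"] that by (simp add: aff_weight_cartan)
  show "\<alpha> = \<beta>" using eq[where b = 0] by (intro dual_eqI[OF assms(2,3)]) simp
  then show "k = j" using eq[OF subspace_0[OF subspace_H], of 1] by simp
qed

lemma delta_multiple: "(\<lambda>x. of_nat k * delta H x) = aff_weight (\<lambda>_. 0) (int k)"
  by (auto simp: delta_def aff_weight_def fun_eq_iff)

section \<open>Layers and support of one ideal\<close>

context
  fixes I assumes I: "I \<in> aff_ideals H Np"
begin

lemma aff_ideal:
  "aff.subspace I" "I \<subseteq> aff_pos Np"
  "\<And>b x. b \<in> aff.borel (aff_cartan H) (aff_pos Np) \<Longrightarrow> x \<in> I \<Longrightarrow> aff_lie b x \<in> I"
  using I by (auto simp: aff_ideals_def aff.borel_ideals_def aff.ideal_of_def)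

lemma subspace_layer: "subspace (layer I k)"
proof -
  have "(single k 0, 0, 0) \<in> I" using aff.subspace_0[OF aff_ideal(1)] by (simp add: zero_prod_def)
  moreover have "(single k (x + y), 0, 0) \<in> I" if "(single k x, 0, 0) \<in> I" "(single k y, 0, 0) \<in> I" for x y
    using aff.subspace_add[OF aff_ideal(1) that] by (simp add: single_add)
  moreover have "(single k (c *s x), 0, 0) \<in> I" if "(single k x, 0, 0) \<in> I" for x c
    using aff.subspace_scale[OF aff_ideal(1) that, of c] by (simp only: aff_scale_single)
  ultimately show ?thesis by (auto simp: subspace_def layer_def)
qed

lemma layer_neg:
  assumes "y \<in> layer I k" "k < 0"
  shows "y = 0"
proof -
  have "(single k y, 0, 0) \<in> aff_pos Np" using assms aff_ideal(2) by (auto simp: layer_def)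
  then show ?thesis using assms by (rule_tac aff_pos_form) (auto, metis lookup_single_eq)
qed

lemma layer_0: "layer I 0 \<subseteq> Np"
proof
  fix y assume "y \<in> layer I 0"
  then have "(single 0 y, 0, 0) \<in> aff_pos Np" using aff_ideal(2) by (auto simp: layer_def)
  then show "y \<in> Np" by (rule aff_pos_form) auto
qed

lemma lie_in_layer:
  assumes y: "y \<in> layer I k" and m: "0 < m \<or> m = 0 \<and> x \<in> borel H Np"
  shows "lie x y \<in> layer I (m + k)"
proof (cases "y = 0")
  case True
  then show ?thesis using subspace_0[OF subspace_layer] by simp
next
  case False
  then have k: "0 \<le> k" using layer_neg[OF y] by linarith
  have "(single m x, 0, 0) \<in> aff.borel (aff_cartan H) (aff_pos Np)"
  proof (cases "0 < m")
    case True
    then have "(single m x, 0, 0) \<in> aff_pos Np" by (rule_tac aff_pos_single) simp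
    moreover have "(0, 0, 0) \<in> aff_cartan H"
      using subspace_0[OF subspace_H] by (auto simp: aff_cartan_iff intro!: bexI[of _ 0])
    ultimately show ?thesis unfolding aff.borel_def
      by (intro CollectI exI[of _ "(0, 0, 0)"] exI[of _ "(single m x, 0, 0)"]) simp
  next
    case False
    then obtain h n where x: "x = h + n" "h \<in> H" "n \<in> Np" "m = 0" using m by (auto simp: borel_def)
    then have "(single 0 n, 0, 0) \<in> aff_pos Np" by (intro aff_pos_single) simp
    moreover have "(single 0 h, 0, 0) \<in> aff_cartan H" using x by (auto simp: aff_cartan_iff)
    ultimately show ?thesis unfolding aff.borel_def using x
      by (intro CollectI exI[of _ "(single 0 h, 0, 0)"] exI[of _ "(single 0 n, 0, 0)"]) (simp add: single_add)
  qed
  then have "aff_lie (single m x, 0, 0) (single k y, 0, 0) \<in> I"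
    by (rule aff_ideal(3)) (use y in \<open>simp add: layer_def\<close>)
  \<comment> \<open>As \<open>k\<close> is nonnegative, the degrees cancel only for
    \<open>m = 0\<close>, where the cocycle carries the factor 0; so no central term
    appears.\<close>
  moreover have "loop_cocycle (single m x) (single k y) = 0"
    using m k by (auto simp: loop_cocycle_single)
  ultimately show ?thesis by (simp add: layer_def loop_lie_single loop_scale_simps)
qed

lemma layer_components:
  assumes "y \<in> layer I k"
  obtains f where "\<And>\<alpha>. \<alpha> \<in> weights \<Longrightarrow> f \<alpha> \<in> g \<alpha> \<inter> layer I k" "y = (\<Sum>\<alpha>\<in>weights. f \<alpha>)"
proof (rule H_invariant_components[OF subspace_layer _ assms])
  show "lie h x \<in> layer I k" if "h \<in> H" "x \<in> layer I k" for h x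
    using lie_in_layer[OF that(2), of 0 h] that(1) H_subset_borel by auto
qed (use that in blast)

lemma occurringI: "\<alpha> \<in> dual H \<Longrightarrow> y \<in> g \<alpha> \<Longrightarrow> y \<in> layer I k \<Longrightarrow> y \<noteq> 0 \<Longrightarrow> (\<alpha>, k) \<in> occurring I"
  by (auto simp: occurring_def)

lemma supp_eq: "supp H Np I = (\<lambda>(\<alpha>, k). aff_weight \<alpha> k) ` occurring I"
proof (intro subset_antisym subsetI)
  fix \<beta> assume \<beta>: "\<beta> \<in> supp H Np I"
  then have dual: "\<beta> \<in> aff.dual (aff_cartan H)" and ne: "I \<inter> aff.root_space (aff_cartan H) \<beta> \<noteq> {0}"
    by (auto simp: supp_def aff_pos_roots_def aff.roots_def)
  have "0 \<in> I \<inter> aff.root_space (aff_cartan H) \<beta>"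
    using aff.subspace_0[OF aff_ideal(1)] by (simp add: aff.root_space_def)
  then obtain z where z: "z \<in> aff.root_space (aff_cartan H) \<beta>" "z \<in> I" "z \<noteq> 0" using ne by blast
  obtain \<alpha> k y where "\<alpha> \<in> dual H" "y \<in> g \<alpha>" "y \<noteq> 0" "z = (single k y, 0, 0)" "\<beta> = aff_weight \<alpha> k"
    by (rule aff_root_space_single[OF dual z(1) _ z(3)]) (use aff_ideal(2) z in blast)+
  then show "\<beta> \<in> (\<lambda>(\<alpha>, k). aff_weight \<alpha> k) ` occurring I"
    using z by (force simp: occurring_def layer_def)
next
  fix \<beta> assume "\<beta> \<in> (\<lambda>(\<alpha>, k). aff_weight \<alpha> k) ` occurring I"
  then obtain \<alpha> k y where \<beta>: "\<beta> = aff_weight \<alpha> k" and \<alpha>: "\<alpha> \<in> dual H" and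
    y: "y \<in> g \<alpha>" "y \<in> layer I k" "y \<noteq> 0" by (auto simp: occurring_def)
  let ?z = "(single k y, 0 :: complex, 0 :: complex)"
  have z: "?z \<in> I" "?z \<in> aff_pos Np" "?z \<noteq> 0"
    using y aff_ideal(2) by (auto simp: layer_def zero_prod_def) (metis lookup_single_eq lookup_zero)
  have zr: "?z \<in> aff.root_space (aff_cartan H) \<beta>" unfolding \<beta> by (rule single_in_aff_root_space[OF y(1)])
  \<comment> \<open>Only the pair \<open>(0, 0)\<close> could give the zero functional, but layer 0
    lies in \<open>Np\<close>, which meets \<open>H\<close> in 0.\<close>
  have "\<beta> \<noteq> (\<lambda>_. 0)"
  proof
    assume "\<beta> = (\<lambda>_. 0)"
    moreover have "aff_weight (\<lambda>_. 0) 0 = (\<lambda>_. 0)" by (auto simp: aff_weight_def)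
    ultimately have "\<alpha> = (\<lambda>_. 0)" "k = 0"
      using aff_weight_eqD[OF _ \<alpha> zero_in_dual, of k 0] \<beta> by auto
    then show False using y layer_0 root_space_0 Np_H_disjoint by auto
  qed
  then have "\<beta> \<in> aff_pos_roots H Np"
    using zr z aff_weight_in_dual[OF \<alpha>, of k] unfolding aff_pos_roots_def aff.roots_def \<beta> by blast
  then show "\<beta> \<in> supp H Np I" using zr z unfolding supp_def by blast
qed

lemma imaginary_occurring_iff:
  "(\<lambda>x. of_nat k * delta H x) \<in> supp H Np I \<longleftrightarrow> ((\<lambda>_. 0), int k) \<in> occurring I"
proof
  assume "(\<lambda>x. of_nat k * delta H x) \<in> supp H Np I"
  then obtain \<alpha> j where o: "(\<alpha>, j) \<in> occurring I" "aff_weight (\<lambda>_. 0) (int k) = aff_weight \<alpha> j"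
    unfolding delta_multiple supp_eq by auto
  moreover have "\<alpha> \<in> dual H" using o by (simp add: occurring_def)
  ultimately show "((\<lambda>_. 0), int k) \<in> occurring I"
    using aff_weight_eqD[OF o(2) zero_in_dual] by simp
qed (force simp: delta_multiple supp_eq)

lemma occurring_weight: "(\<alpha>, k) \<in> occurring I \<Longrightarrow> \<alpha> \<in> weights"
  unfolding occurring_def using rootsI by blast

lemma layer_Np_borel_ideal: "layer I k \<inter> Np \<in> borel_ideals H Np"
proof -
  have "subspace (layer I k \<inter> Np)"
    using subspace_inter[OF subspace_layer subspace_Np] .
  moreover have "lie x y \<in> layer I k \<inter> Np" if "x \<in> borel H Np" "y \<in> layer I k \<inter> Np" for x y
    using that lie_in_layer[of y k 0 x] borel_lie_Np by auto
  ultimately show ?thesis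
    using Np_subset_borel by (auto simp: borel_ideals_def ideal_of_def)
qed

text \<open>The negative part of a layer need not be stable under the Borel subalgebra; its
  orthogonal complement in \<open>Np\<close> carries the same information and is.\<close>

definition annihilator :: "int \<Rightarrow> 'a set" where
  "annihilator k = {x\<in>Np. \<forall>y\<in>layer I k. killing x y = 0}"

text \<open>Invariance of the Killing form moves \<open>b\<close> over to the layer, which is stable
  under bracketing with the Borel subalgebra in degree 0.\<close>

lemma annihilator_borel_ideal: "annihilator k \<in> borel_ideals H Np"
proof -
  have "subspace (annihilator k)"
    using subspace_Np by (auto simp: subspace_def annihilator_def)
  moreover have "lie b x \<in> annihilator k" if "b \<in> borel H Np" "x \<in> annihilator k" for b x
  proof -
    have "killing (lie b x) y = 0" if y: "y \<in> layer I k" for y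
    proof -
      have "killing (lie b x) y = - killing x (lie b y)"
        by (subst lie_skew) (simp add: killing_invariant)
      then show ?thesis
        using lie_in_layer[OF y, of 0 b] \<open>b \<in> borel H Np\<close> \<open>x \<in> annihilator k\<close> by (simp add: annihilator_def)
    qed
    then show ?thesis using that borel_lie_Np by (simp add: annihilator_def)
  qed
  ultimately show ?thesis
    using Np_subset_borel by (auto simp: borel_ideals_def ideal_of_def annihilator_def)
qed

lemma occurring_pos_iff:
  assumes "\<alpha> \<in> pos_roots"
  shows "(\<alpha>, k) \<in> occurring I \<longleftrightarrow> (\<exists>y\<in>g \<alpha>. y \<in> layer I k \<inter> Np \<and> y \<noteq> 0)"
  using assms root_space_pos[OF assms] rootsD(1)[of \<alpha>] by (auto simp: occurring_def pos_roots_def)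

lemma occurring_neg_iff:
  assumes \<alpha>: "\<alpha> \<in> neg_roots"
  shows "(\<alpha>, k) \<in> occurring I \<longleftrightarrow> (\<exists>x\<in>g (\<lambda>h. - \<alpha> h). x \<notin> annihilator k)"
proof
  have neg: "g (\<lambda>h. - \<alpha> h) \<subseteq> Np" by (rule root_space_pos[OF uminus_neg_root[OF \<alpha>]])
  have root: "\<alpha> \<in> roots H" using \<alpha> by (simp add: neg_roots_def)
  show "\<exists>x\<in>g (\<lambda>h. - \<alpha> h). x \<notin> annihilator k" if occ: "(\<alpha>, k) \<in> occurring I"
  proof -
    obtain y where y: "y \<in> g \<alpha>" "y \<in> layer I k" "y \<noteq> 0" using occ by (auto simp: occurring_def)
    obtain x where "x \<in> g (\<lambda>h. - \<alpha> h)" "killing y x \<noteq> 0" using killing_pairing[OF y(1,3)] by blast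
    moreover from this have "x \<notin> annihilator k"
      using y(2) unfolding annihilator_def by (subst (asm) killing_commute) blast
    ultimately show ?thesis by blast
  qed
  assume "\<exists>x\<in>g (\<lambda>h. - \<alpha> h). x \<notin> annihilator k"
  then obtain x y where x: "x \<in> g (\<lambda>h. - \<alpha> h)" and y: "y \<in> layer I k" "killing x y \<noteq> 0"
    using neg by (auto simp: annihilator_def)
  obtain f where f: "\<And>\<beta>. \<beta> \<in> weights \<Longrightarrow> f \<beta> \<in> g \<beta> \<inter> layer I k" "y = (\<Sum>\<beta>\<in>weights. f \<beta>)"
    using layer_components[OF y(1)] by blast
  \<comment> \<open>Only the \<alpha>-component of \<open>y\<close> can pair with \<open>x\<close>,
    so that component is nonzero, and it lies in the layer.\<close>
  have "killing x (f \<beta>) = 0" if \<beta>: "\<beta> \<in> weights" "\<beta> \<noteq> \<alpha>" for \<beta>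
  proof -
    obtain h where "h \<in> H" "\<beta> h \<noteq> \<alpha> h"
      using dual_eqI[OF weights_dual[OF \<beta>(1)] rootsD(1)[OF root]] \<beta>(2) by blast
    then show ?thesis using f(1)[OF \<beta>(1)] by (intro killing_root_space_eq_0[OF x]) auto
  qed
  then have "f \<alpha> \<noteq> 0"
    using y(2) unfolding f(2) killing_sum_right by (metis (no_types, lifting) killing_bilinear(6) sum.neutral)
  then show "(\<alpha>, k) \<in> occurring I"
    using f(1)[of \<alpha>] root rootsD(1)[OF root] by (intro occurringI[of _ "f \<alpha>"]) auto
qed

section \<open>Ideals of a given level\<close>

context
  fixes l assumes l: "has_level H Np I l"
begin

lemma level_occurring: "0 < l" "((\<lambda>_. 0), int l) \<in> occurring I"
  using l imaginary_occurring_iff[of l] by (auto simp: has_level_def)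

lemma level_le:
  assumes "((\<lambda>_. 0), k) \<in> occurring I"
  shows "int l \<le> k"
proof (rule ccontr)
  assume no: "\<not> int l \<le> k"
  obtain y where y: "y \<in> H" "y \<in> layer I k" "y \<noteq> 0"
    using assms root_space_0 by (auto simp: occurring_def)
  \<comment> \<open>The level only speaks of positive degrees; negative degrees have zero layers,
    and in degree 0 no element of \<open>H\<close> other than 0 occurs.\<close>
  then have "k \<ge> 0" using layer_neg by force
  moreover have "k \<noteq> 0" using y layer_0 Np_H_disjoint by auto
  ultimately obtain n where n: "k = int n" "0 < n" "n < l"
    using no by (metis linorder_not_le of_nat_less_iff nonneg_int_cases of_nat_0_less_iff order_le_less)
  then show False using l assms imaginary_occurring_iff[of n] by (auto simp: has_level_def)
qed

text \<open>Bracketing with an opposite root vector lands in \<open>H\<close>. That vector may be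
  used in degree 1, and in degree 0 if \<alpha> is negative, because it then lies in
  \<open>Np\<close>.\<close>

lemma occurring_root_ge:
  assumes "(\<alpha>, k) \<in> occurring I" "\<alpha> \<in> roots H"
  shows "\<alpha> \<in> pos_roots \<Longrightarrow> int l \<le> 1 + k" "\<alpha> \<in> neg_roots \<Longrightarrow> int l \<le> k"
proof -
  obtain y where y: "y \<in> g \<alpha>" "y \<in> layer I k" "y \<noteq> 0" using assms by (auto simp: occurring_def)
  obtain z where z: "z \<in> g (\<lambda>h. - \<alpha> h)" "killing y z \<noteq> 0" using killing_pairing[OF y(1,3)] by blast
  have "lie y z \<in> H" "lie y z \<noteq> 0"
    using lie_opposite_in_H[OF y(1) z(1)] lie_opposite_nonzero[OF assms(2) y(1) z(2)] by auto
  then have zy: "lie z y \<in> g (\<lambda>_. 0)" "lie z y \<noteq> 0"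
    using lie_skew[of y z] subspace_neg[OF subspace_H, of "lie y z"] root_space_0 by auto
  show "int l \<le> 1 + k"
    using lie_in_layer[OF y(2), of 1 z] by (intro level_le occurringI[OF zero_in_dual zy(1) _ zy(2)]) simp
  assume "\<alpha> \<in> neg_roots"
  then have "z \<in> borel H Np" using root_space_pos[OF uminus_neg_root] z Np_subset_borel by blast
  then show "int l \<le> k"
    using lie_in_layer[OF y(2), of 0 z] by (intro level_le occurringI[OF zero_in_dual zy(1) _ zy(2)]) simp
qed

lemma level_element:
  obtains h where "h \<in> H" "h \<noteq> 0" "h \<in> layer I (int l)"
  using level_occurring root_space_0 that by (auto simp: occurring_def)

text \<open>\<open>lie e h\<close> is a nonzero multiple of \<open>e\<close>, and \<open>e\<close>
  acts in degree \<open>k - int l\<close>, which may be 0 only for positive roots.\<close>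

lemma root_space_in_layer:
  assumes h: "h \<in> layer I (int l)" "h \<in> H" and \<gamma>: "\<gamma> h \<noteq> 0"
    and k: "int l < k \<or> k = int l \<and> \<gamma> \<in> pos_roots"
  shows "g \<gamma> \<subseteq> layer I k"
proof
  fix e assume e: "e \<in> g \<gamma>"
  have "0 < k - int l \<or> k - int l = 0 \<and> e \<in> borel H Np"
    using k e root_space_pos[of \<gamma>] Np_subset_borel by auto
  from lie_in_layer[OF h(1) this] have "lie e h \<in> layer I k" by simp
  moreover have "lie e h = (- \<gamma> h) *s e"
    using e h by (subst lie_skew) (simp add: root_space_def)
  ultimately have "(- \<gamma> h) *s e \<in> layer I k" by simp
  from subspace_scale[OF subspace_layer this, of "1 / (- \<gamma> h)"]
  show "e \<in> layer I k" using \<gamma> by simp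
qed

text \<open>A positive root with \<open>\<gamma> h \<noteq> 0\<close> already occurs in degree
  \<open>l\<close>; a vector of the opposite root, used in degree \<open>k - int l > 0\<close>,
  brings it back to \<open>H\<close>.\<close>

lemma imaginary_occurring:
  assumes "int l \<le> k"
  shows "((\<lambda>_. 0), k) \<in> occurring I"
proof (cases "k = int l")
  case True
  then show ?thesis using level_occurring by simp
next
  case False
  obtain h where h: "h \<in> H" "h \<noteq> 0" "h \<in> layer I (int l)" by (rule level_element)
  obtain \<gamma> where "\<gamma> \<in> roots H" "\<gamma> h \<noteq> 0" using root_nonvanishing[OF h(1,2)] by blast
  \<comment> \<open>If the root found is negative, its opposite is positive and does not vanish at
    \<open>h\<close> either.\<close>
  then obtain \<gamma> where \<gamma>: "\<gamma> \<in> pos_roots" "\<gamma> h \<noteq> 0"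
    using roots_split uminus_neg_root[of \<gamma>] by force
  then have root: "\<gamma> \<in> roots H" by (simp add: pos_roots_def)
  obtain y where y: "y \<in> g \<gamma>" "y \<noteq> 0" using rootsD root by blast
  obtain z where z: "z \<in> g (\<lambda>h. - \<gamma> h)" "killing y z \<noteq> 0" using killing_pairing[OF y] by blast
  have "lie y z \<in> H" "lie y z \<noteq> 0"
    using lie_opposite_in_H[OF y(1) z(1)] lie_opposite_nonzero[OF root y(1) z(2)] by auto
  then have zy: "lie z y \<in> g (\<lambda>_. 0)" "lie z y \<noteq> 0"
    using lie_skew[of y z] subspace_neg[OF subspace_H, of "lie y z"] root_space_0 by auto
  have "y \<in> layer I (int l)" using root_space_in_layer[OF h(3,1), of \<gamma> "int l"] \<gamma> y by blast
  from lie_in_layer[OF this, of "k - int l" z] have "lie z y \<in> layer I k"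
    using False assms by simp
  then show ?thesis using zy by (intro occurringI[OF zero_in_dual])
qed

lemma real_occurring:
  assumes \<alpha>: "\<alpha> \<in> roots H" and k: "int l + 2 \<le> k \<or> int l + 1 \<le> k \<and> \<alpha> \<in> pos_roots"
  shows "(\<alpha>, k) \<in> occurring I"
proof -
  obtain h where h: "h \<in> H" "h \<noteq> 0" "h \<in> layer I (int l)" by (rule level_element)
  note dual = rootsD(1)[OF \<alpha>]
  show ?thesis
  proof (cases "\<alpha> h = 0")
    case False
    obtain y where "y \<in> g \<alpha>" "y \<noteq> 0" using rootsD \<alpha> by blast
    then show ?thesis
      using root_space_in_layer[OF h(3,1), of \<alpha> k] False k by (intro occurringI[OF dual]) auto
  next
    case True
    obtain \<gamma> \<delta> x y where \<gamma>: "\<gamma> \<in> roots H" "\<delta> \<in> roots H" "\<gamma> h \<noteq> 0" "\<delta> h \<noteq> 0"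
      "\<alpha> = (\<lambda>k. \<gamma> k + \<delta> k)" "x \<in> g \<gamma>" "y \<in> g \<delta>" "lie x y \<noteq> 0"
      by (rule root_splitting[OF h(1,2) \<alpha> True])
    have xy: "lie x y \<in> g \<alpha>" using lie_root_space[OF \<gamma>(6,7)] \<gamma>(5) by simp
    have layers: "x \<in> layer I j" "y \<in> layer I j" if "int l < j" for j
      using root_space_in_layer[OF h(3,1), of \<gamma> j] root_space_in_layer[OF h(3,1), of \<delta> j] \<gamma> that
      by auto
    have "lie x y \<in> layer I k"
    \<comment> \<open>Both factors occur from degree \<open>l + 1\<close> on. For
      \<open>k \<ge> l + 2\<close> one acts on the other in positive degree; for
      \<open>k = l + 1\<close> the positive one among them acts in degree 0.\<close>
    proof (cases "int l + 2 \<le> k")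
      case True
      then show ?thesis using lie_in_layer[OF layers(2)[of "int l + 1"], of "k - int l - 1" x] by simp
    next
      case False
      then have k: "int l < k" and "\<alpha> \<in> pos_roots" using k by auto
      then consider "\<gamma> \<in> pos_roots" | "\<delta> \<in> pos_roots" using pos_root_of_sum \<gamma> by blast
      then show ?thesis
      proof cases
        case 1
        then have "x \<in> borel H Np" using root_space_pos \<gamma> Np_subset_borel by blast
        then show ?thesis using lie_in_layer[OF layers(2)[OF k], of 0 x] by simp
      next
        case 2
        then have "y \<in> borel H Np" using root_space_pos \<gamma> Np_subset_borel by blast
        then have "lie y x \<in> layer I k" using lie_in_layer[OF layers(1)[OF k], of 0 y] by simp
        then show ?thesis using subspace_neg[OF subspace_layer] lie_skew[of x y] by simp
      qed
    qed
    then show ?thesis using xy \<gamma>(8) by (intro occurringI[OF dual])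
  qed
qed

end

end

section \<open>The four ideals and the count\<close>

text \<open>These are the degrees where the level leaves occurrence open: \<open>l - 1\<close> and
  \<open>l\<close> for positive roots, \<open>l\<close> and \<open>l + 1\<close> for negative
  ones.\<close>

definition invariant :: "nat \<Rightarrow> 'a affine set \<Rightarrow> 'a set \<times> 'a set \<times> 'a set \<times> 'a set" where
  "invariant l I = (layer I (int l - 1) \<inter> Np, layer I (int l) \<inter> Np,
     annihilator I (int l), annihilator I (int l + 1))"

text \<open>Below the open degrees a root cannot occur in \<open>I\<close>, above them it must occur
  in \<open>J\<close>, and in them the components of \<open>invariant\<close> decide.\<close>

lemma occurring_mono_if_invariant_eq:
  assumes I: "I \<in> aff_ideals H Np" "has_level H Np I l" and J: "J \<in> aff_ideals H Np" "has_level H Np J l"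
    and eq: "invariant l I = invariant l J"
  shows "occurring I \<subseteq> occurring J"
proof
  fix p assume p: "p \<in> occurring I"
  obtain \<alpha> k where [simp]: "p = (\<alpha>, k)" by (cases p)
  have "\<alpha> \<in> weights" using occurring_weight[OF I(1)] p by simp
  then consider "\<alpha> = (\<lambda>_. 0)" | "\<alpha> \<in> pos_roots" | "\<alpha> \<in> neg_roots" using roots_split by auto
  then show "p \<in> occurring J"
  proof cases
    case 1
    then show ?thesis using level_le[OF I] imaginary_occurring[OF J] p by simp
  next
    case 2
    then have root: "\<alpha> \<in> roots H" by (simp add: pos_roots_def)
    have "int l \<le> 1 + k" using occurring_root_ge(1)[OF I _ root 2] p by simp
    then consider "k = int l - 1" | "k = int l" | "int l + 1 \<le> k" by linarith
    then show ?thesis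
      using real_occurring[OF J root, of k] 2 p eq occurring_pos_iff[OF I(1) 2] occurring_pos_iff[OF J(1) 2]
      by cases (auto simp: invariant_def)
  next
    case 3
    then have root: "\<alpha> \<in> roots H" by (simp add: neg_roots_def)
    have "int l \<le> k" using occurring_root_ge(2)[OF I _ root 3] p by simp
    then consider "k = int l" | "k = int l + 1" | "int l + 2 \<le> k" by linarith
    then show ?thesis
      using real_occurring[OF J root, of k] p eq occurring_neg_iff[OF I(1) 3] occurring_neg_iff[OF J(1) 3]
      by cases (auto simp: invariant_def)
  qed
qed

theorem card_supports_of_level:
  "finite (supports_of_level H Np l) \<and> card (supports_of_level H Np l) \<le> card (borel_ideals H Np) ^ 4"
proof -
  define L where "L = {I \<in> aff_ideals H Np. I \<noteq> {0} \<and> has_level H Np I l}"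
  let ?B = "borel_ideals H Np"
  have "supports_of_level H Np l = supp H Np ` L"
    by (auto simp: supports_of_level_def L_def)
  moreover have "finite (supp H Np ` L) \<and> card (supp H Np ` L) \<le> card (?B \<times> ?B \<times> ?B \<times> ?B)"
  proof (rule card_image_le_if_determined)
    show "finite (?B \<times> ?B \<times> ?B \<times> ?B)" using finite_borel_ideals by simp
    show "invariant l ` L \<subseteq> ?B \<times> ?B \<times> ?B \<times> ?B"
      using layer_Np_borel_ideal annihilator_borel_ideal by (auto simp: L_def invariant_def)
    fix I J assume "I \<in> L" "J \<in> L" "invariant l I = invariant l J"
    then have "occurring I = occurring J"
      by (intro subset_antisym occurring_mono_if_invariant_eq) (auto simp: L_def)
    then show "supp H Np I = supp H Np J"
      using \<open>I \<in> L\<close> \<open>J \<in> L\<close> supp_eq by (simp add: L_def)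
  qed
  ultimately show ?thesis by (simp add: card_cartesian_product power4_eq_xxxx mult.assoc)
qed

end

theorem corollary24:
  fixes scale :: "complex \<Rightarrow> 'a::ab_group_add \<Rightarrow> 'a"
    and lie :: "'a \<Rightarrow> 'a \<Rightarrow> 'a"
    and Nm H Np :: "'a set"
    and l :: nat
  assumes "simple_lie_algebra scale lie"
    and "lie_algebra.triangular_decomposition scale lie Nm H Np"
    and "0 < l"
  shows "finite (finite_dimensional_lie_algebra.supports_of_level scale lie H Np l) \<and>
         card (finite_dimensional_lie_algebra.supports_of_level scale lie H Np l)
           \<le> card (lie_algebra.borel_ideals scale lie H Np) ^ 4"
proof -
  interpret simple_lie_algebra scale lie by (rule assms)
  \<comment> \<open>The base comes from the existential statement inside the triangular
    decomposition.\<close>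
  obtain \<Pi> where "triangular_simple_lie_algebra scale lie Nm H Np \<Pi>"
    using assms(2) unfolding triangular_decomposition_def
    by (auto intro!: triangular_simple_lie_algebra.intro triangular_simple_lie_algebra_axioms.intro
        simple_lie_algebra_axioms)
  then interpret triangular_simple_lie_algebra scale lie Nm H Np \<Pi> .
  show ?thesis by (rule card_supports_of_level)
qed

end
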